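(* Let $T$ be a tree on $n$ vertices. (1) For $n=2,3,4$, the star $K_{1,n-1}$ is the unique tree on $n$ vertices with minimum $\mathcal{E}$-energy. (2) For $n\geq 5$, the tree $T_{n,3}^{0,n-4}$ has the minimum $\mathcal{E}$-energy among all trees on $n$ vertices.
   Context: For a connected graph $G$ on $n$ vertices, the eccentricity matrix $\mathcal{E}(G)$ is the matrix indexed by $V(G)$ with $(u,v)$-entry $d_G(u,v)$ if $d_G(u,v)=\min\{e_G(u),e_G(v)\}$ and $0$ otherwise, where $d_G$ is the distance and $e_G(u)=\max_v d_G(u,v)$ the eccentricity. The $\mathcal{E}$-energy is $E_{\mathcal{E}}(G)=\sum_{i=1}^n|\xi_i(G)|$, where $\xi_1(G)\geq\cdots\geq\xi_n(G)$ are the eigenvalues of $\mathcal{E}(G)$. $K_{1,n-1}$ is the star on $n$ vertices. $T_{n,3}^{0,n-4}$ is the tree obtained from the path $v_0v_1v_2v_3$ by attaching $n-4$ pendant vertices to $v_2$. *)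

theory Defs
  imports
    "Graph_Theory.Graph_Theory"
    "Jordan_Normal_Form.Char_Poly"
    "HOL-Library.Multiset"
begin

text \<open>
  A finite simple graph is a \<^locale>\<open>pair_graph\<close>: a finite loopfree symmetric digraph without
  parallel arcs, each edge being a pair of opposite arcs. The library's predicate
  \<^const>\<open>Digraph_Component.tree\<close> cannot be used here, because for the library the two arcs
  \<open>[(u,v), (v,u)]\<close> of a single edge already form a cycle. The cycles of the
  underlying undirected graph are the directed cycles of length at least 3.
\<close>

definition is_tree :: "'a pair_pre_digraph \<Rightarrow> bool" where
  "is_tree G \<longleftrightarrow> pair_graph G \<and> Digraph_Component.connected (with_proj G) \<and>
     (\<nexists>p. pre_digraph.cycle (with_proj G) p \<and> 3 \<le> length p)"

definition tree_on :: "nat \<Rightarrow> 'a pair_pre_digraph \<Rightarrow> bool" where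
  "tree_on n G \<longleftrightarrow> is_tree G \<and> card (pverts G) = n"

text \<open>
  The library's shortest-path distance for unit arc weights. It is an extended real, finite
  whenever \<open>v\<close> is reachable from \<open>u\<close>; the coercion to reals is only meaningful in that case.
\<close>

definition gdist :: "'a pair_pre_digraph \<Rightarrow> 'a \<Rightarrow> 'a \<Rightarrow> real" where
  "gdist G u v = real_of_ereal (wf_digraph.\<mu> (with_proj G) (\<lambda>_. 1) u v)"

definition eccentricity :: "'a pair_pre_digraph \<Rightarrow> 'a \<Rightarrow> real" where
  "eccentricity G u = Max (gdist G u ` pverts G)"

definition ecc_entry :: "'a pair_pre_digraph \<Rightarrow> 'a \<Rightarrow> 'a \<Rightarrow> real" where
  "ecc_entry G u v =
     (if gdist G u v = min (eccentricity G u) (eccentricity G v) then gdist G u v else 0)"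

text \<open>
  Library matrices are indexed by \<open>{..<n}\<close>, so an ordering of the vertices is needed. Another
  ordering gives a permutation-similar matrix, hence the same characteristic polynomial.
\<close>

definition vertex_list :: "'a pair_pre_digraph \<Rightarrow> 'a list" where
  "vertex_list G = (SOME vs. distinct vs \<and> set vs = pverts G)"

definition ecc_matrix :: "'a pair_pre_digraph \<Rightarrow> real mat" where
  "ecc_matrix G = mat (card (pverts G)) (card (pverts G))
     (\<lambda>(i, j). ecc_entry G (vertex_list G ! i) (vertex_list G ! j))"

text \<open>
  The matrix is real and symmetric, so the real roots of its characteristic polynomial, counted
  with multiplicity, are all of its \<open>n\<close> eigenvalues.
\<close>

definition ecc_eigenvalues :: "'a pair_pre_digraph \<Rightarrow> real multiset" where
  "ecc_eigenvalues G = proots (char_poly (ecc_matrix G))"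

definition ecc_energy :: "'a pair_pre_digraph \<Rightarrow> real" where
  "ecc_energy G = (\<Sum>\<xi>\<in>#ecc_eigenvalues G. \<bar>\<xi>\<bar>)"

definition star :: "nat \<Rightarrow> nat pair_pre_digraph" where
  "star n = \<lparr> pverts = {..<n}, parcs = symcl {(0, i) | i. 1 \<le> i \<and> i < n} \<rparr>"

lemma star_complete_bipartite:
  assumes "n \<ge> 1"
  shows "complete_bipartite_digraph 1 (n - 1) (with_proj (star n))"
proof -
  have arcs: "parcs (star n) = {0} \<times> {1..<n} \<union> {1..<n} \<times> {0}"
    by (auto simp: star_def symcl_def)
  have verts: "pverts (star n) = {0} \<union> {1..<n}"
    using assms by (auto simp: star_def)
  have fin: "finite (pverts (star n))" "finite (parcs (star n))"
    by (auto simp: verts arcs)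
  interpret pair_graph "star n"
    by unfold_locales (auto simp: fin, auto simp: verts arcs symmetric_def sym_def)
  have "\<exists>U V. pverts (star n) = U \<union> V \<and> U \<inter> V = {} \<and> card U = 1 \<and> card V = n - 1 \<and>
      parcs (star n) = U \<times> V \<union> V \<times> U"
    by (rule exI[of _ "{0}"], rule exI[of _ "{1..<n}"]) (simp add: verts arcs)
  then show ?thesis
    unfolding complete_bipartite_digraph_def using graph_axioms by simp
qed

text \<open>
  The path \<open>v\<^sub>0 v\<^sub>1 v\<^sub>2 v\<^sub>3\<close> on the vertices \<open>0, 1, 2, 3\<close>, with the pendant vertices
  \<open>4, \<dots>, n - 1\<close> attached to \<open>2\<close>; meant for \<open>n \<ge> 4\<close>.
\<close>

definition T3 :: "nat \<Rightarrow> nat pair_pre_digraph" where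
  "T3 n = \<lparr> pverts = {..<n},
     parcs = symcl ({(0, 1), (1, 2), (2, 3)} \<union> {(2, i) | i. 4 \<le> i \<and> i < n}) \<rparr>"

end

theory Submission
  imports Defs "Jordan_Normal_Form.Schur_Decomposition"
begin

text \<open>
  Writing \<open>\<epsilon>\<close> for the entries of the eccentricity matrix, a vanishing trace gives
  \<open>E\<^sup>2 \<ge> 2 \<Sum>\<^sub>u\<Sum>\<^sub>v \<epsilon>(u,v)\<^sup>2\<close>. In a tree of diameter \<open>d \<ge> 4\<close> every vertex \<open>u\<close> is at distance
  \<open>e(u)\<close> from an end of a fixed diametral path, and with a few exceptions on that path this contributes
  at least 16 per vertex. The resulting linear bound beats the energy of \<open>T3 n\<close>, whose square is
  only about \<open>52 n\<close>. Trees of diameter at most 2 are stars and those of diameter 3 are double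
  stars; in both cases the possible eigenvalues are found by solving the eigenvector equations, and the
  energy follows by writing the absolute value on them as a polynomial and using traces of powers.
\<close>

section \<open>Traces and the real spectrum\<close>

text \<open>Acyclicity is given only as the absence of directed cycles with at least 3 arcs. It
  enters once: seen from a root \<open>r\<close>, a vertex has at most one neighbour that is not
  farther from \<open>r\<close> than itself. Parity of distances, the fact that walks without
  backtracking are geodesics, and the projection of every vertex to a diametral path all follow from
  this. The numerical margins dictate how sharp each estimate must be. At \<open>n = 5\<close> a
  quarter of the squared energy of \<open>T3 n\<close> is 30 + 8 sqrt 2, about 41.3, while the bound
  for diameter at least 4 gives 42; so the light vertices on the diametral path have to be counted
  exactly. The threshold between the two claims comes from the star: its energy grows linearly in
  \<open>n\<close>, that of \<open>T3 n\<close> like the square root, and the order changes between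
  4 vertices (4 + 2 sqrt 7 against 10) and 5. Among double stars with \<open>a\<close> and
  \<open>b\<close> leaves the energy increases with the product \<open>a * b\<close> for fixed
  \<open>a + b\<close>, which singles out \<open>a = 1\<close>.\<close>

definition mat_trace :: "'a::comm_ring_1 mat \<Rightarrow> 'a" where
  "mat_trace A = (\<Sum>i<dim_row A. A $$ (i, i))"

lemma index_mult_mat_sum:
  assumes "A \<in> carrier_mat n m" "B \<in> carrier_mat m k" "i < n" "j < k"
  shows "(A * B) $$ (i, j) = (\<Sum>l<m. A $$ (i, l) * B $$ (l, j))"
  using assms by (auto simp: scalar_prod_def lessThan_atLeast0 intro!: sum.cong)

lemma mat_trace_mult:
  assumes "A \<in> carrier_mat n m" "B \<in> carrier_mat m n"
  shows "mat_trace (A * B) = (\<Sum>i<n. \<Sum>j<m. A $$ (i, j) * B $$ (j, i))"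
  using assms by (auto simp: mat_trace_def index_mult_mat_sum simp del: index_mult_mat(1) intro!: sum.cong)

lemma mat_trace_comm:
  fixes A :: "'a::comm_ring_1 mat"
  assumes "A \<in> carrier_mat n m" "B \<in> carrier_mat m n"
  shows "mat_trace (A * B) = mat_trace (B * A)"
  unfolding mat_trace_mult[OF assms] mat_trace_mult[OF assms(2,1)]
  by (subst sum.swap) (simp add: mult.commute)

lemma mat_trace_similar:
  fixes A :: "'a::comm_ring_1 mat"
  assumes "similar_mat_wit A B P Q"
  shows "mat_trace A = mat_trace B"
proof -
  from assms obtain n where c: "A \<in> carrier_mat n n" "B \<in> carrier_mat n n" "P \<in> carrier_mat n n"
    "Q \<in> carrier_mat n n" and QP: "Q * P = 1\<^sub>m n" and A: "A = P * B * Q"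
    unfolding similar_mat_wit_def Let_def by auto
  have "mat_trace A = mat_trace (Q * (P * B))"
    unfolding A by (rule mat_trace_comm) (use c in auto)
  also have "Q * (P * B) = Q * P * B" using c by (simp add: assoc_mult_mat)
  finally show ?thesis using c QP by simp
qed

lemma upper_triangular_mult:
  fixes A :: "'a::comm_ring_1 mat"
  assumes c: "A \<in> carrier_mat n n" "B \<in> carrier_mat n n"
    and ut: "upper_triangular A" "upper_triangular B"
  shows "upper_triangular (A * B)"
    and "i < n \<Longrightarrow> (A * B) $$ (i, i) = A $$ (i, i) * B $$ (i, i)"
proof -
  \<comment> \<open>A nonzero term needs i \<le> l \<le> j, so for j \<le> i only l = i = j
    survives. This gives both claims.\<close>
  have 0: "A $$ (i, l) * B $$ (l, j) = 0" if "i < n" "j < n" "l < n" "j \<le> i" "l \<noteq> i \<or> j < i" for i j l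
    using upper_triangularD[OF ut(1), of l i] upper_triangularD[OF ut(2), of j l] that c
    by (cases "l < i") auto
  show "upper_triangular (A * B)"
    using c by (intro upper_triangularI) (auto simp: index_mult_mat_sum[OF c] simp del: index_mult_mat(1) intro!: sum.neutral 0)
  show "(A * B) $$ (i, i) = A $$ (i, i) * B $$ (i, i)" if "i < n"
  proof -
    have "(A * B) $$ (i, i) = (\<Sum>l<n. A $$ (i, l) * B $$ (l, i))"
      using index_mult_mat_sum[OF c] that by simp
    also have "\<dots> = (\<Sum>l\<in>{i}. A $$ (i, l) * B $$ (l, i))"
      by (rule sum.mono_neutral_right) (use that 0 in auto)
    finally show ?thesis by simp
  qed
qed

lemma upper_triangular_pow:
  fixes A :: "'a::comm_ring_1 mat"
  assumes "A \<in> carrier_mat n n" "upper_triangular A"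
  shows "upper_triangular (A ^\<^sub>m k)" "i < n \<Longrightarrow> (A ^\<^sub>m k) $$ (i, i) = (A $$ (i, i)) ^ k"
proof (induction k)
  case 0
  { case 1 show ?case using assms by (simp add: upper_triangular_one) }
  { case 2 then show ?case using assms by simp }
next
  case (Suc k)
  have c: "A ^\<^sub>m k \<in> carrier_mat n n" using assms by simp
  { case 1 show ?case using upper_triangular_mult(1)[OF c assms(1) Suc(1) assms(2)] by simp }
  { case 2 then show ?case using upper_triangular_mult(2)[OF c assms(1) Suc(1) assms(2), of i] Suc(2)
      by (simp add: mult.commute) }
qed

text \<open>Schur triangularization puts \<open>es\<close> on the diagonal; powers of a triangular
  matrix carry the powers of its diagonal entries, and similarity preserves the trace.\<close>

lemma mat_trace_pow_roots:
  fixes A :: "'a::conjugatable_ordered_field mat"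
  assumes A: "A \<in> carrier_mat n n" and cp: "char_poly A = (\<Prod>e\<leftarrow>es. [:- e, 1:])"
  shows "mat_trace (A ^\<^sub>m k) = (\<Sum>e\<leftarrow>es. e ^ k)"
proof -
  obtain B P Q where "schur_decomposition A es = (B, P, Q)" by (cases "schur_decomposition A es")
  note s = schur_decomposition[OF A cp this]
  then have sim: "similar_mat_wit A B P Q" and ut: "upper_triangular B" and d: "diag_mat B = es" by auto
  have B: "B \<in> carrier_mat n n" using similar_mat_witD2[OF A sim] by auto
  have "mat_trace (A ^\<^sub>m k) = mat_trace (B ^\<^sub>m k)"
    by (rule mat_trace_similar[OF similar_mat_wit_pow[OF sim]])
  also have "\<dots> = (\<Sum>i<n. (B $$ (i, i)) ^ k)"
    using B upper_triangular_pow(2)[OF B ut] by (auto simp: mat_trace_def intro!: sum.cong)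
  also have "\<dots> = (\<Sum>e\<leftarrow>es. e ^ k)"
    using B unfolding d[symmetric] diag_mat_def
    by (simp add: interv_sum_list_conv_sum_set_nat lessThan_atLeast0 comp_def)
  finally show ?thesis .
qed

text \<open>The Hermitian form \<open>S\<close> of the eigenvector equals \<open>a * N\<close>, with
  \<open>N\<close> its squared norm, and symmetry makes \<open>S\<close> its own conjugate.\<close>

lemma symmetric_eigenvalue_real:
  fixes A :: "real mat"
  assumes A: "A \<in> carrier_mat n n" and sym: "\<And>i j. i < n \<Longrightarrow> j < n \<Longrightarrow> A $$ (i, j) = A $$ (j, i)"
    and ev: "eigenvalue (map_mat complex_of_real A) a"
  shows "a \<in> \<real>"
proof -
  let ?C = "map_mat complex_of_real A"
  from ev obtain v where v: "v \<in> carrier_vec n" "v \<noteq> 0\<^sub>v n" "?C *\<^sub>v v = a \<cdot>\<^sub>v v"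
    using A unfolding eigenvalue_def eigenvector_def by auto
  have row: "(\<Sum>j<n. of_real (A $$ (i, j)) * v $ j) = a * v $ i" if "i < n" for i
  proof -
    have "(?C *\<^sub>v v) $ i = (\<Sum>j<n. of_real (A $$ (i, j)) * v $ j)"
      using that A v(1) by (auto simp: scalar_prod_def lessThan_atLeast0 intro!: sum.cong)
    then show ?thesis using v that by simp
  qed
  define N where "N = (\<Sum>i<n. (cmod (v $ i))\<^sup>2)"
  define S where "S = (\<Sum>i<n. cnj (v $ i) * (\<Sum>j<n. of_real (A $$ (i, j)) * v $ j))"
  have S: "S = a * of_real N"
  proof -
    have "S = (\<Sum>i<n. cnj (v $ i) * (a * v $ i))"
      unfolding S_def by (intro sum.cong refl arg_cong2[where f = times] row) auto
    also have "\<dots> = a * of_real N"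
      unfolding N_def of_real_sum sum_distrib_left complex_norm_square
      by (intro sum.cong) (simp_all add: mult_ac)
    finally show ?thesis .
  qed
  have "cnj S = (\<Sum>i<n. \<Sum>j<n. v $ i * of_real (A $$ (i, j)) * cnj (v $ j))"
    unfolding S_def by (simp add: sum_distrib_left mult.assoc)
  also have "\<dots> = (\<Sum>j<n. \<Sum>i<n. v $ i * of_real (A $$ (i, j)) * cnj (v $ j))"
    by (rule sum.swap)
  also have "\<dots> = S"
    unfolding S_def sum_distrib_left by (intro sum.cong) (auto simp: sym mult_ac)
  finally have "S \<in> \<real>" by (simp add: complex_is_Real_iff complex_eq_iff)
  moreover have "N \<noteq> 0"
  proof
    assume "N = 0"
    then have "\<forall>i<n. v $ i = 0" unfolding N_def by (subst (asm) sum_nonneg_eq_0_iff) auto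
    with v show False by (auto simp: vec_eq_iff)
  qed
  ultimately show ?thesis using S
    by (metis Reals_divide Reals_of_real nonzero_mult_div_cancel_right of_real_eq_0_iff)
qed

text \<open>The polynomial splits over the complex numbers with real roots only, so its
  factorization is the image of a real one. Injectivity of the coefficient embedding brings it back
  to the reals.\<close>

lemma symmetric_char_poly_splits:
  fixes A :: "real mat"
  assumes A: "A \<in> carrier_mat n n" and sym: "\<And>i j. i < n \<Longrightarrow> j < n \<Longrightarrow> A $$ (i, j) = A $$ (j, i)"
  obtains es where "char_poly A = (\<Prod>e\<leftarrow>es. [:- e, 1:])"
proof -
  interpret h: map_poly_inj_idom_hom complex_of_real ..
  let ?C = "map_mat complex_of_real A"
  have C: "?C \<in> carrier_mat n n" using A by simp
  obtain as where as: "char_poly ?C = (\<Prod>a\<leftarrow>as. [:- a, 1:])" using char_poly_factorized[OF C] by auto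
  have real: "a \<in> \<real>" if "a \<in> set as" for a
  proof -
    have "poly (char_poly ?C) a = 0"
      unfolding as poly_prod_list using that by (auto simp: prod_list_zero_iff intro!: image_eqI[of _ _ a])
    then have "eigenvalue ?C a" using eigenvalue_root_char_poly[OF C] by simp
    then show ?thesis using symmetric_eigenvalue_real[OF A sym] by blast
  qed
  have "map_poly complex_of_real (char_poly A) = char_poly ?C"
    by (rule of_real_hom.char_poly_hom[OF A, symmetric])
  also have "\<dots> = (\<Prod>a\<leftarrow>as. map_poly complex_of_real [:- Re a, 1:])"
    unfolding as using real by (intro arg_cong[where f = prod_list] map_cong)
      (auto simp: of_real_Re)
  also have "\<dots> = map_poly complex_of_real (\<Prod>a\<leftarrow>as. [:- Re a, 1:])"
    by (simp add: h.hom_prod_list comp_def)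
  finally have "char_poly A = (\<Prod>a\<leftarrow>as. [:- Re a, 1:])"
    by (rule h.injectivity)
  then show ?thesis by (intro that[of "map Re as"]) (simp add: comp_def)
qed

lemma proots_linear_factors:
  fixes es :: "'a::idom list"
  shows "proots (\<Prod>e\<leftarrow>es. [:- e, 1:]) = mset es"
proof -
  have "(\<Prod>e\<leftarrow>es. [:- e, 1:]) \<noteq> 0" by (auto simp: prod_list_zero_iff)
  then show ?thesis
    by (induction es) (auto simp: proots_mult prod_list_zero_iff simp del: mult_pCons_left)
qed

section \<open>Energy of symmetric kernels\<close>

text \<open>Positions in an enumeration \<open>vs\<close> serve as indices. The power traces below
  then become sums over the vertex set, whatever the enumeration; \<open>ecc_matrix\<close> is the
  instance with \<open>vertex_list\<close> and \<open>ecc_entry\<close>.\<close>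

definition kernel_matrix :: "'a list \<Rightarrow> ('a \<Rightarrow> 'a \<Rightarrow> real) \<Rightarrow> real mat" where
  "kernel_matrix vs f = mat (length vs) (length vs) (\<lambda>(i, j). f (vs ! i) (vs ! j))"

definition kernel_spectrum :: "'a list \<Rightarrow> ('a \<Rightarrow> 'a \<Rightarrow> real) \<Rightarrow> real multiset" where
  "kernel_spectrum vs f = proots (char_poly (kernel_matrix vs f))"

definition kernel_energy :: "'a list \<Rightarrow> ('a \<Rightarrow> 'a \<Rightarrow> real) \<Rightarrow> real" where
  "kernel_energy vs f = (\<Sum>\<xi>\<in>#kernel_spectrum vs f. \<bar>\<xi>\<bar>)"

locale symmetric_kernel =
  fixes vs :: "'a list" and f :: "'a \<Rightarrow> 'a \<Rightarrow> real"
  assumes distinct: "distinct vs"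
    and sym: "u \<in> set vs \<Longrightarrow> v \<in> set vs \<Longrightarrow> f u v = f v u"
begin

abbreviation "V \<equiv> set vs"
abbreviation "M \<equiv> kernel_matrix vs f"

lemma carrier: "M \<in> carrier_mat (length vs) (length vs)"
  by (simp add: kernel_matrix_def)

lemma sum_index: "(\<Sum>i<length vs. g (vs ! i)) = (\<Sum>v\<in>V. g v)" for g :: "'a \<Rightarrow> real"
  using distinct by (intro sum.reindex_bij_betw bij_betw_nth) auto

lemma square_index:
  assumes "i < length vs" "j < length vs"
  shows "(M * M) $$ (i, j) = (\<Sum>w\<in>V. f (vs ! i) w * f w (vs ! j))"
proof -
  have "(M * M) $$ (i, j) = (\<Sum>l<length vs. f (vs ! i) (vs ! l) * f (vs ! l) (vs ! j))"
    using assms by (subst index_mult_mat_sum[OF carrier carrier])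
      (auto simp: kernel_matrix_def intro!: sum.cong)
  then show ?thesis using sum_index[of "\<lambda>w. f (vs ! i) w * f w (vs ! j)"] by simp
qed

lemma spectrum_roots:
  obtains es where "char_poly M = (\<Prod>e\<leftarrow>es. [:- e, 1:])" "kernel_spectrum vs f = mset es"
proof -
  obtain es where es: "char_poly M = (\<Prod>e\<leftarrow>es. [:- e, 1:])"
    by (rule symmetric_char_poly_splits[OF carrier]) (auto simp: kernel_matrix_def sym)
  then show ?thesis
    by (intro that[OF es]) (simp add: kernel_spectrum_def es proots_linear_factors)
qed

lemma sum_power_spectrum: "(\<Sum>\<xi>\<in>#kernel_spectrum vs f. \<xi> ^ k) = mat_trace (M ^\<^sub>m k)"
proof -
  obtain es where "char_poly M = (\<Prod>e\<leftarrow>es. [:- e, 1:])" "kernel_spectrum vs f = mset es"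
    by (rule spectrum_roots)
  then show ?thesis using mat_trace_pow_roots[OF carrier, of es k]
    by (simp add: sum_mset_sum_list flip: mset_map)
qed

lemma size_spectrum: "real (size (kernel_spectrum vs f)) = card V"
  using sum_power_spectrum[of 0] distinct
  by (simp add: mat_trace_def kernel_matrix_def distinct_card)

lemma sum_spectrum: "sum_mset (kernel_spectrum vs f) = (\<Sum>v\<in>V. f v v)"
  using sum_power_spectrum[of 1] sum_index[of "\<lambda>v. f v v"]
  by (simp add: mat_trace_def kernel_matrix_def)

lemma sum_square_spectrum:
  "(\<Sum>\<xi>\<in>#kernel_spectrum vs f. \<xi>\<^sup>2) = (\<Sum>u\<in>V. \<Sum>v\<in>V. (f u v)\<^sup>2)"
proof -
  have "M ^\<^sub>m 2 = M * M" using carrier by (simp add: numeral_2_eq_2)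
  then have "(\<Sum>\<xi>\<in>#kernel_spectrum vs f. \<xi>\<^sup>2) = (\<Sum>i<length vs. (M * M) $$ (i, i))"
    using carrier by (simp add: sum_power_spectrum mat_trace_def)
  also have "\<dots> = (\<Sum>i<length vs. \<Sum>w\<in>V. f (vs ! i) w * f w (vs ! i))"
    by (intro sum.cong refl square_index) auto
  also have "\<dots> = (\<Sum>u\<in>V. \<Sum>w\<in>V. f u w * f w u)"
    by (rule sum_index[of "\<lambda>u. \<Sum>w\<in>V. f u w * f w u"])
  also have "\<dots> = (\<Sum>u\<in>V. \<Sum>v\<in>V. (f u v)\<^sup>2)"
    by (intro sum.cong refl) (simp add: sym power2_eq_square)
  finally show ?thesis .
qed

text \<open>As \<open>M * M\<close> is again symmetric, the trace of its square is the sum of its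
  squared entries.\<close>

lemma sum_fourth_power_spectrum:
  "(\<Sum>\<xi>\<in>#kernel_spectrum vs f. \<xi> ^ 4) = (\<Sum>u\<in>V. \<Sum>v\<in>V. (\<Sum>w\<in>V. f u w * f w v)\<^sup>2)"
proof -
  define g where "g u v = (\<Sum>w\<in>V. f u w * f w v)" for u v
  have gsym: "g u v = g v u" if "u \<in> V" "v \<in> V" for u v
    unfolding g_def using that by (intro sum.cong refl) (simp add: sym mult.commute)
  have c: "M * M \<in> carrier_mat (length vs) (length vs)" using carrier by simp
  have "M ^\<^sub>m 4 = (M * M) * (M * M)"
    using carrier by (simp add: numeral_eq_Suc assoc_mult_mat[of _ "length vs" "length vs" _ "length vs" _ "length vs"])
  then have "(\<Sum>\<xi>\<in>#kernel_spectrum vs f. \<xi> ^ 4) = mat_trace ((M * M) * (M * M))"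
    by (simp add: sum_power_spectrum)
  also have "\<dots> = (\<Sum>i<length vs. \<Sum>j<length vs. g (vs ! i) (vs ! j) * g (vs ! j) (vs ! i))"
    unfolding mat_trace_mult[OF c c] g_def
    by (intro sum.cong refl arg_cong2[where f = times] square_index) auto
  also have "\<dots> = (\<Sum>i<length vs. \<Sum>v\<in>V. g (vs ! i) v * g v (vs ! i))"
    by (intro sum.cong refl sum_index)
  also have "\<dots> = (\<Sum>u\<in>V. \<Sum>v\<in>V. g u v * g v u)"
    by (rule sum_index[of "\<lambda>u. \<Sum>v\<in>V. g u v * g v u"])
  also have "\<dots> = (\<Sum>u\<in>V. \<Sum>v\<in>V. (g u v)\<^sup>2)"
    by (intro sum.cong refl) (simp add: gsym power2_eq_square)
  finally show ?thesis by (simp add: g_def)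
qed

text \<open>Reads an eigenvector as a function on the vertices. Summing its equations over classes
  of interchangeable vertices leaves a small linear system, which locates the spectrum without
  evaluating a determinant.\<close>

lemma spectrum_eigenfunction:
  assumes "\<xi> \<in># kernel_spectrum vs f"
  obtains x v where "v \<in> V" "x v \<noteq> 0" "\<And>u. u \<in> V \<Longrightarrow> (\<Sum>v\<in>V. f u v * x v) = \<xi> * x u"
proof -
  have "poly (char_poly M) \<xi> = 0"
    using assms degree_monic_char_poly[OF carrier] unfolding kernel_spectrum_def
    by (cases "char_poly M = 0") auto
  then have "eigenvalue M \<xi>" using eigenvalue_root_char_poly[OF carrier] by simp
  then obtain y where y: "y \<in> carrier_vec (length vs)" "y \<noteq> 0\<^sub>v (length vs)" "M *\<^sub>v y = \<xi> \<cdot>\<^sub>v y"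
    using carrier unfolding eigenvalue_def eigenvector_def by auto
  define idx where "idx v = (THE i. i < length vs \<and> vs ! i = v)" for v
  have idx: "idx (vs ! i) = i" if "i < length vs" for i
    unfolding idx_def using that distinct by (intro the_equality) (auto simp: nth_eq_iff_index_eq)
  define x where "x v = y $ idx v" for v
  have "(\<Sum>v\<in>V. f (vs ! i) v * x v) = \<xi> * x (vs ! i)" if i: "i < length vs" for i
  proof -
    have "(\<Sum>v\<in>V. f (vs ! i) v * x v) = (\<Sum>j<length vs. f (vs ! i) (vs ! j) * x (vs ! j))"
      by (rule sum_index[symmetric])
    also have "\<dots> = (M *\<^sub>v y) $ i"
      using i y(1) by (auto simp: kernel_matrix_def scalar_prod_def x_def idx lessThan_atLeast0 intro!: sum.cong)
    finally show ?thesis using i y by (simp add: x_def idx)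
  qed
  then have eq: "(\<Sum>v\<in>V. f u v * x v) = \<xi> * x u" if "u \<in> V" for u
    using that by (auto simp: in_set_conv_nth)
  from y(1,2) obtain i where "i < length vs" "y $ i \<noteq> 0" by (auto simp: vec_eq_iff)
  then show ?thesis using idx eq by (intro that[of "vs ! i" x]) (auto simp: x_def)
qed

text \<open>The positive and the negative eigenvalues have the same absolute sum \<open>E / 2\<close> when the
  trace vanishes, and each part bounds its own sum of squares by \<open>E\<^sup>2 / 4\<close>.\<close>

lemma energy_square_ge:
  assumes "\<And>v. v \<in> V \<Longrightarrow> f v v = 0"
  shows "2 * (\<Sum>u\<in>V. \<Sum>v\<in>V. (f u v)\<^sup>2) \<le> (kernel_energy vs f)\<^sup>2"
proof -
  define P where "P E = (\<Sum>\<xi>\<in>#E. max \<xi> 0)" for E :: "real multiset"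
  define N where "N E = (\<Sum>\<xi>\<in>#E. max (- \<xi>) 0)" for E :: "real multiset"
  have nn: "0 \<le> P E" "0 \<le> N E" for E
    unfolding P_def N_def by (induction E) auto
  have sq: "(\<Sum>\<xi>\<in>#E. \<xi>\<^sup>2) \<le> (P E)\<^sup>2 + (N E)\<^sup>2" for E
  proof (induction E)
    case (add x E)
    have PN: "P (add_mset x E) = max x 0 + P E" "N (add_mset x E) = max (- x) 0 + N E"
      by (auto simp: P_def N_def)
    \<comment> \<open>At most one of the two maxima is nonzero, and its cross term with
      \<open>P E\<close> or \<open>N E\<close> is nonnegative.\<close>
    have "x\<^sup>2 + (P E)\<^sup>2 + (N E)\<^sup>2 \<le> (max x 0 + P E)\<^sup>2 + (max (- x) 0 + N E)\<^sup>2"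
      using nn[of E] by (cases "x \<ge> 0") (auto simp: power2_sum power2_diff mult_nonneg_nonneg mult_nonneg_nonpos)
    with add show ?case unfolding PN by simp
  qed (simp add: P_def N_def)
  have "P E - N E = sum_mset E" for E
    unfolding P_def N_def by (induction E) auto
  from this[of "kernel_spectrum vs f"] have 1: "P (kernel_spectrum vs f) = N (kernel_spectrum vs f)"
    using assms by (simp add: sum_spectrum)
  have "P E + N E = (\<Sum>\<xi>\<in>#E. \<bar>\<xi>\<bar>)" for E
    unfolding P_def N_def by (induction E) auto
  with 1 have "kernel_energy vs f = 2 * P (kernel_spectrum vs f)"
    by (metis kernel_energy_def mult_2)
  with sq[of "kernel_spectrum vs f"] 1 show ?thesis
    by (simp add: sum_square_spectrum power_mult_distrib)
qed

text \<open>Interpolating the absolute value by a polynomial on the spectrum expresses the energy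
  through traces of powers, so multiplicities need not be determined.\<close>

lemma energy_interpolation:
  assumes "\<And>\<xi>. \<xi> \<in># kernel_spectrum vs f \<Longrightarrow> \<bar>\<xi>\<bar> = \<alpha> + \<beta> * \<xi> + \<gamma> * \<xi>\<^sup>2 + \<delta> * \<xi> ^ 4"
  shows "kernel_energy vs f = \<alpha> * card V + \<beta> * (\<Sum>v\<in>V. f v v) + \<gamma> * (\<Sum>u\<in>V. \<Sum>v\<in>V. (f u v)\<^sup>2)
    + \<delta> * (\<Sum>u\<in>V. \<Sum>v\<in>V. (\<Sum>w\<in>V. f u w * f w v)\<^sup>2)"
proof -
  have "kernel_energy vs f = (\<Sum>\<xi>\<in>#kernel_spectrum vs f. \<alpha> + \<beta> * \<xi> + \<gamma> * \<xi>\<^sup>2 + \<delta> * \<xi> ^ 4)"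
    unfolding kernel_energy_def using assms by (intro arg_cong[where f = sum_mset] image_mset_cong)
  moreover have "(\<Sum>\<xi>\<in>#E. \<alpha> + \<beta> * \<xi> + \<gamma> * \<xi>\<^sup>2 + \<delta> * \<xi> ^ 4)
    = \<alpha> * size E + \<beta> * sum_mset E + \<gamma> * (\<Sum>\<xi>\<in>#E. \<xi>\<^sup>2) + \<delta> * (\<Sum>\<xi>\<in>#E. \<xi> ^ 4)"
    for E :: "real multiset"
    by (induction E) (simp_all add: distrib_left)
  ultimately have "kernel_energy vs f = \<alpha> * size (kernel_spectrum vs f) + \<beta> * sum_mset (kernel_spectrum vs f)
      + \<gamma> * (\<Sum>\<xi>\<in>#kernel_spectrum vs f. \<xi>\<^sup>2) + \<delta> * (\<Sum>\<xi>\<in>#kernel_spectrum vs f. \<xi> ^ 4)"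
    by (rule trans)
  then show ?thesis
    by (simp add: size_spectrum sum_spectrum sum_square_spectrum sum_fourth_power_spectrum)
qed

end

section \<open>Energies of stars and double stars\<close>

text \<open>Outside the eigenvalue -2 an eigenfunction is constant on \<open>L\<close>. The
  equations for its value at \<open>c\<close> and its sum over \<open>L\<close> then force
  \<open>\<xi>\<^sup>2 - 2 * A * \<xi> - (A + 1) = 0\<close>, whose roots are
  \<open>A + D > 0\<close> and \<open>A - D < 0\<close>.\<close>

lemma kernel_energy_star:
  assumes vs: "distinct vs" "set vs = insert c L" and c: "c \<notin> L" and L: "L \<noteq> {}"
    and cc: "f c c = 0" and cl: "\<And>l. l \<in> L \<Longrightarrow> f c l = 1 \<and> f l c = 1"
    and ll: "\<And>l l'. l \<in> L \<Longrightarrow> l' \<in> L \<Longrightarrow> f l l' = (if l = l' then 0 else 2)"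
  shows "kernel_energy vs f = 2 * (real (card L) - 1) + 2 * sqrt ((real (card L))\<^sup>2 - real (card L) + 1)"
proof -
  have fin: "finite L" by (metis vs(2) finite_insert finite_set)
  interpret symmetric_kernel vs f
    by unfold_locales (use vs cc cl ll in auto)
  define A where "A = real (card L) - 1"
  define D where "D = sqrt (A\<^sup>2 + A + 1)"
  have A: "A \<ge> 0" using L fin unfolding A_def by (simp add: Suc_leI card_gt_0_iff)
  have D2: "D\<^sup>2 = A\<^sup>2 + A + 1" unfolding D_def using A by simp
  have D: "D > A"
    unfolding D_def using A by (intro real_less_rsqrt) simp
  have sumV: "(\<Sum>v\<in>V. g v) = g c + (\<Sum>l\<in>L. g l)" for g :: "_ \<Rightarrow> real"
    using vs c fin by simp
  have sumL: "(\<Sum>v\<in>L. f l v * g v) = 2 * ((\<Sum>v\<in>L. g v) - g l)" if "l \<in> L" for l and g :: "_ \<Rightarrow> real"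
  proof -
    have "(\<Sum>v\<in>L. f l v * g v) = f l l * g l + (\<Sum>v\<in>L - {l}. f l v * g v)"
      using that fin by (simp add: sum.remove)
    also have "(\<Sum>v\<in>L - {l}. f l v * g v) = (\<Sum>v\<in>L - {l}. 2 * g v)"
      using that by (intro sum.cong) (auto simp: ll)
    also have "\<dots> = 2 * ((\<Sum>v\<in>L. g v) - g l)"
      using that fin by (simp add: sum.remove sum_distrib_left)
    finally show ?thesis using that by (simp add: ll)
  qed
  have cV: "c \<in> V" "\<And>l. l \<in> L \<Longrightarrow> l \<in> V" using vs by auto
  have cardV: "real (card V) = A + 2" using fin c by (simp add: vs A_def)
  have trace: "(\<Sum>v\<in>V. f v v) = 0" by (simp add: sumV cc ll)
  have trace2: "(\<Sum>u\<in>V. \<Sum>v\<in>V. (f u v)\<^sup>2) = 2 * (A + 1) * (2 * A + 1)"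
  proof -
    have "(\<Sum>v\<in>L. (f l v)\<^sup>2) = 4 * A" if l: "l \<in> L" for l
    proof -
      have "(\<Sum>v\<in>L. (f l v)\<^sup>2) = (\<Sum>v\<in>L. f l v * f l v)" by (simp add: power2_eq_square)
      also have "\<dots> = 2 * ((\<Sum>v\<in>L. f l v) - f l l)" by (rule sumL[OF l])
      also have "(\<Sum>v\<in>L. f l v) = 2 * A" using sumL[OF l, of "\<lambda>_. 1"] by (simp add: A_def)
      finally show ?thesis using l by (simp add: ll)
    qed
    then have "(\<Sum>l\<in>L. \<Sum>v\<in>L. (f l v)\<^sup>2) = (A + 1) * (4 * A)"
      by (simp add: A_def)
    then have "(\<Sum>u\<in>V. \<Sum>v\<in>V. (f u v)\<^sup>2) = (A + 1) + (A + 1) * (1 + 4 * A)"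
      by (simp add: sumV cc cl sum.distrib) (simp add: A_def algebra_simps)
    then show ?thesis by (simp add: algebra_simps)
  qed
  have roots: "\<xi> = - 2 \<or> (\<xi> - A)\<^sup>2 = D\<^sup>2" if \<xi>: "\<xi> \<in># kernel_spectrum vs f" for \<xi>
  proof (rule disjCI)
    assume "(\<xi> - A)\<^sup>2 \<noteq> D\<^sup>2"
    obtain x v where x: "v \<in> V" "x v \<noteq> 0" "\<And>u. u \<in> V \<Longrightarrow> (\<Sum>v\<in>V. f u v * x v) = \<xi> * x u"
      using spectrum_eigenfunction[OF \<xi>] by blast
    define S where "S = (\<Sum>l\<in>L. x l)"
    have 1: "\<xi> * x c = S"
      using x(3)[of c] cV by (simp add: sumV cc cl S_def)
    have 2: "(\<xi> + 2) * x l = x c + 2 * S" if "l \<in> L" for l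
      using x(3)[of l] sumL[OF that, of x] that cV by (simp add: sumV cl S_def) (simp add: algebra_simps)
    show "\<xi> = - 2"
    proof (rule ccontr)
      assume ne: "\<xi> \<noteq> - 2"
      have "(\<xi> + 2) * S = (\<Sum>l\<in>L. x c + 2 * S)"
        unfolding S_def sum_distrib_left by (intro sum.cong refl) (use 2 in \<open>simp add: S_def sum_distrib_left\<close>)
      then have 3: "(\<xi> + 2) * S = (A + 1) * (x c + 2 * S)" by (simp add: A_def)
      from 3 1 have "((\<xi> - A)\<^sup>2 - D\<^sup>2) * x c = 0"
        unfolding D2 by (simp add: power2_eq_square algebra_simps)
      with \<open>(\<xi> - A)\<^sup>2 \<noteq> D\<^sup>2\<close> have "x c = 0" by simp
      with 1 2 ne have "x l = 0" if "l \<in> L" for l using that by simp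
      with \<open>x c = 0\<close> x vs show False by auto
    qed
  qed
  \<comment> \<open>The quadratic \<open>\<xi> * (\<xi> - A) / D\<close> is the absolute value at
    both \<open>A + D\<close> and \<open>A - D\<close>. Adding \<open>\<kappa>\<close> times the
    quadratic that vanishes there corrects the value at -2, where that quadratic equals
    \<open>3 * A + 3\<close>.\<close>
  define \<kappa> where "\<kappa> = (2 - 2 * (A + 2) / D) / (3 * A + 3)"
  have "\<bar>\<xi>\<bar> = - \<kappa> * (A + 1) + (- A / D - 2 * \<kappa> * A) * \<xi> + (1 / D + \<kappa>) * \<xi>\<^sup>2 + 0 * \<xi> ^ 4"
    if "\<xi> \<in># kernel_spectrum vs f" for \<xi>
  proof -
    have "\<bar>\<xi>\<bar> = \<xi> * (\<xi> - A) / D + \<kappa> * (\<xi>\<^sup>2 - 2 * A * \<xi> - (A + 1))"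
      using roots[OF that]
    proof
      assume \<xi>: "\<xi> = - 2"
      have "\<kappa> * (3 * A + 3) = 2 - 2 * (A + 2) / D" using A by (simp add: \<kappa>_def)
      moreover have "\<kappa> * (\<xi>\<^sup>2 - 2 * A * \<xi> - (A + 1)) = \<kappa> * (3 * A + 3)"
        unfolding \<xi> by (simp add: algebra_simps)
      ultimately show ?thesis unfolding \<xi> using D A by (simp add: field_simps)
    next
      assume \<xi>: "(\<xi> - A)\<^sup>2 = D\<^sup>2"
      then have "\<xi>\<^sup>2 - 2 * A * \<xi> - (A + 1) = 0" unfolding D2 by (simp add: power2_eq_square algebra_simps)
      moreover have "\<xi> = A + D \<or> \<xi> = A - D" using \<xi> by (auto simp: power2_eq_iff)
      then have "\<bar>\<xi>\<bar> = \<xi> * (\<xi> - A) / D" using D A by auto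
      ultimately show ?thesis by simp
    qed
    also have "\<dots> = - \<kappa> * (A + 1) + (- A / D - 2 * \<kappa> * A) * \<xi> + (1 / D + \<kappa>) * \<xi>\<^sup>2"
      by (simp add: power2_eq_square algebra_simps diff_divide_distrib)
    finally show ?thesis by simp
  qed
  from energy_interpolation[OF this]
  have "kernel_energy vs f = - \<kappa> * (A + 1) * (A + 2) + (1 / D + \<kappa>) * (2 * (A + 1) * (2 * A + 1))"
    unfolding trace trace2 cardV by simp
  also have "\<dots> = (\<kappa> * (3 * A + 3)) * A + (2 * (A + 1) * (2 * A + 1)) / D"
    by (simp add: algebra_simps add_divide_distrib)
  also have "\<dots> = (2 - 2 * (A + 2) / D) * A + (2 * (A + 1) * (2 * A + 1)) / D"
    using A by (simp add: \<kappa>_def)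
  also have "\<dots> = 2 * A + (2 * (A + 1) * (2 * A + 1) - 2 * (A + 2) * A) / D"
    by (simp only: left_diff_distrib diff_divide_distrib times_divide_eq_left)
  also have "\<dots> = 2 * A + 2 * D\<^sup>2 / D"
    unfolding D2 by (simp add: power2_eq_square algebra_simps)
  also have "\<dots> = 2 * A + 2 * D" using D A by (simp add: power2_eq_square)
  also have "D = sqrt ((real (card L))\<^sup>2 - real (card L) + 1)"
    unfolding D_def A_def by (simp add: power2_eq_square algebra_simps)
  finally show ?thesis by (simp add: A_def)
qed

text \<open>The centres are \<open>p\<close> and \<open>q\<close>, with pendant vertices \<open>A\<close> and \<open>B\<close> respectively.\<close>

lemma kernel_energy_double_star:
  fixes f :: "'a \<Rightarrow> 'a \<Rightarrow> real"
  assumes vs: "distinct vs" "set vs = insert p A \<union> insert q B"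
    and disj: "insert p A \<inter> insert q B = {}" "p \<notin> A" "q \<notin> B" and ne: "A \<noteq> {}" "B \<noteq> {}"
    and X: "\<And>u v. u \<in> insert p A \<Longrightarrow> v \<in> insert p A \<Longrightarrow> f u v = 0"
    and Y: "\<And>u v. u \<in> insert q B \<Longrightarrow> v \<in> insert q B \<Longrightarrow> f u v = 0"
    and pq: "f p q = 0" "f q p = 0"
    and Aq: "\<And>u. u \<in> A \<Longrightarrow> f u q = 2" "\<And>u. u \<in> A \<Longrightarrow> f q u = 2"
    and Bp: "\<And>u. u \<in> B \<Longrightarrow> f u p = 2" "\<And>u. u \<in> B \<Longrightarrow> f p u = 2"
    and AB: "\<And>u v. u \<in> A \<Longrightarrow> v \<in> B \<Longrightarrow> f u v = 3" "\<And>u v. u \<in> A \<Longrightarrow> v \<in> B \<Longrightarrow> f v u = 3"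
  defines "a \<equiv> real (card A)" and "b \<equiv> real (card B)"
  shows "kernel_energy vs f = 2 * sqrt (9 * a * b + 4 * (a + b) + 8 * sqrt (a * b))"
proof -
  have fin: "finite A" "finite B" using vs(2) by (metis finite_Un finite_insert finite_set)+
  interpret symmetric_kernel vs f
  proof
    fix u v assume "u \<in> set vs" "v \<in> set vs"
    then show "f u v = f v u"
      unfolding vs(2) using disj by (auto simp: X Y pq Aq Bp AB)
  qed (fact vs(1))
  have ab: "a > 0" "b > 0" using ne fin unfolding a_def b_def by (auto simp: card_gt_0_iff)
  have sumV: "(\<Sum>v\<in>V. g v) = g p + (\<Sum>v\<in>A. g v) + g q + (\<Sum>v\<in>B. g v)" for g :: "_ \<Rightarrow> real"
    using fin disj unfolding vs(2) by (subst sum.union_disjoint) auto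
  have row_A: "(\<Sum>v\<in>V. f u v * g v) = 3 * (\<Sum>v\<in>B. g v) + 2 * g q" if "u \<in> A" for u and g :: "_ \<Rightarrow> real"
    using that by (simp add: sumV X Aq AB sum_distrib_left)
  have row_p: "(\<Sum>v\<in>V. f p v * g v) = 2 * (\<Sum>v\<in>B. g v)" for g :: "_ \<Rightarrow> real"
    by (simp add: sumV X pq Bp sum_distrib_left)
  have row_B: "(\<Sum>v\<in>V. f u v * g v) = 3 * (\<Sum>v\<in>A. g v) + 2 * g p" if "u \<in> B" for u and g :: "_ \<Rightarrow> real"
    using that by (simp add: sumV Y Bp AB sum_distrib_left)
  have row_q: "(\<Sum>v\<in>V. f q v * g v) = 2 * (\<Sum>v\<in>A. g v)" for g :: "_ \<Rightarrow> real"
    by (simp add: sumV Y pq Aq sum_distrib_left)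
  note rows = row_A row_p row_B row_q
  \<comment> \<open>The nonzero eigenvalues will be roots of
    \<open>\<xi> ^ 4 - \<pi> * \<xi>\<^sup>2 + r\<^sup>2\<close>. This has two positive roots, with
    product \<open>r\<close> and sum \<open>s\<close>, and their negatives; hence the expected
    energy \<open>2 * s\<close>.\<close>
  define \<pi> where "\<pi> = 9 * a * b + 4 * (a + b)"
  define r where "r = 4 * sqrt (a * b)"
  define s where "s = sqrt (\<pi> + 2 * r)"
  have r: "r > 0" "r\<^sup>2 = 16 * a * b" unfolding r_def using ab by (simp_all add: power_mult_distrib)
  have \<pi>: "\<pi> > 0" unfolding \<pi>_def using ab by (simp add: add_pos_pos)
  have s: "s > 0" "s\<^sup>2 = \<pi> + 2 * r" unfolding s_def using r(1) \<pi> by simp_all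
  have trace: "(\<Sum>v\<in>V. f v v) = 0" by (simp add: sumV X Y)
  have trace2: "(\<Sum>u\<in>V. \<Sum>v\<in>V. (f u v)\<^sup>2) = 2 * \<pi>"
    unfolding power2_eq_square
    by (simp add: sumV[of "\<lambda>u. \<Sum>v\<in>V. f u v * f u v"] rows pq Aq Bp AB)
      (simp add: \<pi>_def algebra_simps flip: a_def b_def)
  have trace4: "(\<Sum>u\<in>V. \<Sum>v\<in>V. (\<Sum>w\<in>V. f u w * f w v)\<^sup>2) = 2 * \<pi>\<^sup>2 - 4 * r\<^sup>2"
    by (simp add: sumV[of "\<lambda>u. \<Sum>v\<in>V. (\<Sum>w\<in>V. f u w * f w v)\<^sup>2"] rows pq Aq Bp AB)
      (simp add: sumV pq Aq Bp AB X Y power2_eq_square flip: a_def b_def,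
       simp add: \<pi>_def r(2)[unfolded power2_eq_square] algebra_simps)
  have roots: "\<xi> = 0 \<or> \<xi> ^ 4 = \<pi> * \<xi>\<^sup>2 - r\<^sup>2" if \<xi>: "\<xi> \<in># kernel_spectrum vs f" for \<xi>
  proof (rule disjCI)
    assume ne: "\<xi> ^ 4 \<noteq> \<pi> * \<xi>\<^sup>2 - r\<^sup>2"
    obtain x v where x: "v \<in> V" "x v \<noteq> 0" "\<And>u. u \<in> V \<Longrightarrow> (\<Sum>v\<in>V. f u v * x v) = \<xi> * x u"
      using spectrum_eigenfunction[OF \<xi>] by blast
    define S T where "S = (\<Sum>v\<in>A. x v)" and "T = (\<Sum>v\<in>B. x v)"
    have eA: "\<xi> * x u = 3 * T + 2 * x q" if "u \<in> A" for u
      using x(3)[of u] row_A[OF that, of x] that vs by (simp add: T_def)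
    have eB: "\<xi> * x u = 3 * S + 2 * x p" if "u \<in> B" for u
      using x(3)[of u] row_B[OF that, of x] that vs by (simp add: S_def)
    have ep: "\<xi> * x p = 2 * T" using x(3)[of p] row_p[of x] vs by (simp add: T_def)
    have eq: "\<xi> * x q = 2 * S" using x(3)[of q] row_q[of x] vs by (simp add: S_def)
    have "\<xi> * S = (\<Sum>v\<in>A. 3 * T + 2 * x q)"
      unfolding S_def sum_distrib_left by (intro sum.cong refl eA)
    then have ES: "\<xi> * S = a * (3 * T + 2 * x q)" by (simp add: a_def)
    have "\<xi> * T = (\<Sum>v\<in>B. 3 * S + 2 * x p)"
      unfolding T_def sum_distrib_left by (intro sum.cong refl eB)
    then have ET: "\<xi> * T = b * (3 * S + 2 * x p)" by (simp add: b_def)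
    show "\<xi> = 0"
    proof (rule ccontr)
      assume \<xi>0: "\<xi> \<noteq> 0"
      \<comment> \<open>Multiplying by \<open>\<xi>\<close> eliminates the values at the centres
        through \<open>ep\<close> and \<open>eq\<close>. What remains is a linear system in
        \<open>S\<close> and \<open>T\<close> whose determinant is the quartic.\<close>
      have "\<xi> * (\<xi> * S) = a * (3 * (\<xi> * T) + 2 * (\<xi> * x q))" unfolding ES by (simp add: algebra_simps)
      then have S2: "(\<xi>\<^sup>2 - 4 * a) * S = 3 * a * \<xi> * T"
        unfolding eq by (simp add: power2_eq_square algebra_simps)
      have "\<xi> * (\<xi> * T) = b * (3 * (\<xi> * S) + 2 * (\<xi> * x p))" unfolding ET by (simp add: algebra_simps)
      then have T2: "(\<xi>\<^sup>2 - 4 * b) * T = 3 * b * \<xi> * S"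
        unfolding ep by (simp add: power2_eq_square algebra_simps)
      have poly: "\<xi> ^ 4 - (\<pi> * \<xi>\<^sup>2 - r\<^sup>2) = (\<xi>\<^sup>2 - 4 * a) * (\<xi>\<^sup>2 - 4 * b) - 9 * a * b * \<xi>\<^sup>2"
        unfolding r(2) \<pi>_def by (simp add: power2_eq_square power4_eq_xxxx algebra_simps)
      have "(\<xi> ^ 4 - (\<pi> * \<xi>\<^sup>2 - r\<^sup>2)) * S = (\<xi>\<^sup>2 - 4 * b) * ((\<xi>\<^sup>2 - 4 * a) * S) - 9 * a * b * \<xi>\<^sup>2 * S"
        unfolding poly by (simp add: algebra_simps)
      also have "\<dots> = 3 * a * \<xi> * ((\<xi>\<^sup>2 - 4 * b) * T) - 9 * a * b * \<xi>\<^sup>2 * S"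
        unfolding S2 by (simp add: algebra_simps)
      also have "\<dots> = 0" unfolding T2 by (simp add: power2_eq_square algebra_simps)
      finally have S0: "S = 0" using ne by simp
      have "3 * a * \<xi> * T = 0" unfolding S2[symmetric] S0 by simp
      then have T0: "T = 0" using ab \<xi>0 by simp
      have "x p = 0" "x q = 0" using ep eq S0 T0 \<xi>0 by auto
      moreover from this have "x u = 0" if "u \<in> A \<union> B" for u
        using that eA[of u] eB[of u] S0 T0 \<xi>0 by auto
      ultimately show False using x(1,2) vs(2) by auto
    qed
  qed
  \<comment> \<open>On nonzero eigenvalues the quartic says
    \<open>(\<xi>\<^sup>2 + r)\<^sup>2 = (s * \<xi>)\<^sup>2\<close>, so the absolute value is
    \<open>(\<xi>\<^sup>2 + r) / s\<close>. This is wrong at 0; trading the constant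
    \<open>r\<^sup>2\<close> for \<open>\<pi> * \<xi>\<^sup>2 - \<xi> ^ 4\<close> gives a polynomial
    that also vanishes there.\<close>
  define k where "k = 1 / (r * s)"
  have k: "k * r * s = 1" unfolding k_def using r(1) s(1) by simp
  have "\<bar>\<xi>\<bar> = 0 + 0 * \<xi> + k * (r + \<pi>) * \<xi>\<^sup>2 + - k * \<xi> ^ 4"
    if "\<xi> \<in># kernel_spectrum vs f" for \<xi>
  proof (cases "\<xi> = 0")
    case False
    then have q4: "\<xi> ^ 4 = \<pi> * \<xi>\<^sup>2 - r\<^sup>2" using roots[OF that] by simp
    have "(\<xi>\<^sup>2 + r)\<^sup>2 = \<xi> ^ 4 + 2 * r * \<xi>\<^sup>2 + r\<^sup>2" by (simp add: power2_sum)
    also have "\<dots> = (s * \<bar>\<xi>\<bar>)\<^sup>2"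
      unfolding power_mult_distrib s(2) power2_abs q4 by (simp add: algebra_simps)
    finally have sq: "(\<xi>\<^sup>2 + r)\<^sup>2 = (s * \<bar>\<xi>\<bar>)\<^sup>2" .
    have "\<xi>\<^sup>2 + r = s * \<bar>\<xi>\<bar>"
      by (rule power2_eq_imp_eq[OF sq]) (use s(1) r(1) in auto)
    then have "\<bar>\<xi>\<bar> = k * r * (\<xi>\<^sup>2 + r)" using k by simp
    also have "\<dots> = k * (r + \<pi>) * \<xi>\<^sup>2 + - k * \<xi> ^ 4"
      unfolding q4 by (simp add: power2_eq_square algebra_simps)
    finally show ?thesis by simp
  qed simp
  from energy_interpolation[OF this]
  have "kernel_energy vs f = k * (r + \<pi>) * (2 * \<pi>) + - k * (2 * \<pi>\<^sup>2 - 4 * r\<^sup>2)"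
    by (simp add: trace trace2 trace4)
  also have "\<dots> = 2 * (k * r * s\<^sup>2)"
    unfolding s(2) by (simp add: power2_eq_square algebra_simps)
  also have "\<dots> = 2 * s" using k by (simp add: power2_eq_square mult.assoc[symmetric])
  finally show ?thesis by (simp add: s_def \<pi>_def r_def)
qed

section \<open>Distances in trees\<close>

locale tree_graph = pair_graph G for G :: "'a pair_pre_digraph" +
  assumes tree: "is_tree G"
begin

lemma no_long_cycle: "cycle p \<Longrightarrow> length p < 3"
  using tree unfolding is_tree_def by (meson not_le)

lemma verts_nonempty: "pverts G \<noteq> {}"
  and walk_exists: "u \<in> pverts G \<Longrightarrow> v \<in> pverts G \<Longrightarrow> \<exists>p. awalk u p v"
proof -
  have c: "connected (with_proj G)" using tree by (simp add: is_tree_def)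
  then show "pverts G \<noteq> {}" by (auto simp: connected_def strongly_connected_def)
  assume "u \<in> pverts G" "v \<in> pverts G"
  with c have "u \<rightarrow>\<^sup>*\<^bsub>with_proj (mk_symmetric (with_proj G))\<^esub> v"
    by (auto simp: connected_def strongly_connected_def)
  then show "\<exists>p. awalk u p v"
    using reachable_mk_symmetric_eq[OF sym_arcs] by (simp add: reachable_awalk)
qed

text \<open>The distance as a natural number, so that case distinctions on distances become linear
  arithmetic; \<open>gdist_hop\<close> links it to the extended real one.\<close>

definition hop :: "'a \<Rightarrow> 'a \<Rightarrow> nat" where
  "hop u v = (LEAST k. \<exists>p. awalk u p v \<and> length p = k)"

lemma hop_walk:
  assumes "u \<in> pverts G" "v \<in> pverts G"
  obtains p where "awalk u p v" "length p = hop u v"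
proof -
  have "\<exists>k p. awalk u p v \<and> length p = k" using walk_exists[OF assms] by blast
  then have "\<exists>p. awalk u p v \<and> length p = hop u v" unfolding hop_def by (rule LeastI_ex)
  then show ?thesis using that by blast
qed

lemma hop_le: "awalk u p v \<Longrightarrow> hop u v \<le> length p"
  unfolding hop_def by (rule Least_le) blast

lemma awalk_cost_unit: "awalk_cost (\<lambda>_. 1) p = real (length p)"
  by (induction p) auto

lemma gdist_hop:
  assumes "u \<in> pverts G" "v \<in> pverts G"
  shows "gdist G u v = real (hop u v)"
proof -
  obtain p where p: "awalk u p v" "length p = hop u v" by (rule hop_walk[OF assms])
  have "\<mu> (\<lambda>_. 1) u v = ereal (real (hop u v))"
    unfolding \<mu>_def awalk_cost_unit
  proof (rule INF_eqI)
    show "y \<le> ereal (hop u v)" if "\<And>q. q \<in> {p. awalk u p v} \<Longrightarrow> y \<le> ereal (length q)" for y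
      using that[of p] p by simp
  qed (simp add: hop_le)
  then show ?thesis by (simp add: gdist_def)
qed

lemma hop_commute:
  assumes "u \<in> pverts G" "v \<in> pverts G"
  shows "hop u v = hop v u"
proof -
  have len: "length (rev_path p) = length p" for p :: "('a \<times> 'a) list" by (induction p) auto
  have le: "hop v u \<le> hop u v" if uv: "u \<in> pverts G" "v \<in> pverts G" for u v
  proof -
    obtain p where "awalk u p v" "length p = hop u v" by (rule hop_walk[OF uv])
    then show ?thesis using hop_le[of v "rev_path p" u] by (simp add: len)
  qed
  show ?thesis using le[OF assms] le[OF assms(2,1)] by simp
qed

lemma hop_triangle:
  assumes "u \<in> pverts G" "v \<in> pverts G" "w \<in> pverts G"
  shows "hop u w \<le> hop u v + hop v w"
proof -
  obtain p where p: "awalk u p v" "length p = hop u v" by (rule hop_walk[OF assms(1,2)])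
  obtain q where q: "awalk v q w" "length q = hop v w" by (rule hop_walk[OF assms(2,3)])
  show ?thesis using hop_le[OF awalk_appendI[OF p(1) q(1)]] p q by simp
qed

lemma hop_self [simp]: "u \<in> pverts G \<Longrightarrow> hop u u = 0"
  using hop_le[of u "[]" u] by (simp add: awalk_Nil_iff)

lemma hop_eq_0_iff: "u \<in> pverts G \<Longrightarrow> v \<in> pverts G \<Longrightarrow> hop u v = 0 \<longleftrightarrow> u = v"
  by (metis awalk_empty_ends hop_self hop_walk length_0_conv)

lemma hop_arc: "(u, v) \<in> parcs G \<Longrightarrow> hop u v = 1"
proof -
  assume uv: "(u, v) \<in> parcs G"
  then have "hop u v \<le> 1"
    using hop_le[of u "[(u, v)]" v] in_arcsD2[OF uv] by (simp add: awalk_simps)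
  moreover have "hop u v \<noteq> 0"
    using uv hop_eq_0_iff in_arcsD1[OF uv] in_arcsD2[OF uv] no_loops'[OF uv] by auto
  ultimately show ?thesis by simp
qed

lemma hop_predecessor:
  assumes "u \<in> pverts G" "v \<in> pverts G" "u \<noteq> v"
  obtains w where "(v, w) \<in> parcs G" "hop u v = Suc (hop u w)"
proof -
  obtain p where p: "awalk u p v" "length p = hop u v" by (rule hop_walk[OF assms(1,2)])
  with assms have "p \<noteq> []" by (auto simp: awalk_Nil_iff)
  then obtain q e where q: "p = q @ [e]" by (metis append_butlast_last_id)
  obtain w where w: "e = (w, v)" "(w, v) \<in> parcs G" "awalk u q w"
    using p(1) unfolding q by (cases e) (auto simp: awalk_simps)
  have "hop u w \<le> length q" by (rule hop_le[OF w(3)])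
  moreover have "hop u v \<le> hop u w + 1"
    using hop_triangle[of u w v] hop_arc[OF w(2)] assms in_arcsD1[OF w(2)] by simp
  ultimately have "hop u v = Suc (hop u w)" using p(2) q by simp
  then show ?thesis using that arcs_symmetric[OF w(2)] by blast
qed

lemma hop_1_iff: "u \<in> pverts G \<Longrightarrow> v \<in> pverts G \<Longrightarrow> hop u v = 1 \<longleftrightarrow> (u, v) \<in> parcs G"
proof
  assume uv: "u \<in> pverts G" "v \<in> pverts G" "hop u v = 1"
  then have "u \<noteq> v" using hop_self by auto
  then obtain w where "(v, w) \<in> parcs G" "hop u v = Suc (hop u w)" using hop_predecessor uv by blast
  then show "(u, v) \<in> parcs G" using uv hop_eq_0_iff[of u w] in_arcsD2 arcs_symmetric by auto
qed (simp add: hop_arc)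

text \<open>The part of the walk that reaches \<open>v\<close> already uses length
  \<open>hop r w\<close>, so nothing is left to lead from \<open>v\<close> to
  \<open>w\<close>.\<close>

lemma shortest_walk_avoids:
  assumes "awalk r p w" "length p = hop r w" "v \<noteq> w" "hop r w \<le> hop r v"
  shows "v \<notin> set (awalk_verts r p)"
proof
  assume "v \<in> set (awalk_verts r p)"
  then obtain q s where qs: "p = q @ s" "awalk r q v" "awalk v s w"
    using awalk_decomp[OF assms(1)] by blast
  with hop_le[OF qs(2)] assms(2,4) have "length s = 0" unfolding qs(1) length_append by linarith
  then have "s = []" by simp
  with qs(3) assms(3) show False by (simp add: awalk_Nil_iff)
qed

text \<open>Two such neighbours would be joined through \<open>r\<close> by a path avoiding \<open>v\<close>, which closes up
  to a cycle through \<open>v\<close>.\<close>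

lemma unique_closer_neighbour:
  assumes r: "r \<in> pverts G" and w: "(v, w1) \<in> parcs G" "(v, w2) \<in> parcs G"
    and le: "hop r w1 \<le> hop r v" "hop r w2 \<le> hop r v"
  shows "w1 = w2"
proof (rule ccontr)
  assume ne: "w1 \<noteq> w2"
  have V: "v \<in> pverts G" "w1 \<in> pverts G" "w2 \<in> pverts G" using w wellformed' by auto
  have vw: "v \<noteq> w1" "v \<noteq> w2" using w no_loops' by auto
  obtain p1 where p1: "awalk r p1 w1" "length p1 = hop r w1" by (rule hop_walk[OF r V(2)])
  obtain p2 where p2: "awalk r p2 w2" "length p2 = hop r w2" by (rule hop_walk[OF r V(3)])
  have a1: "v \<notin> set (awalk_verts r p1)" using shortest_walk_avoids[OF p1 vw(1) le(1)] .
  have a2: "v \<notin> set (awalk_verts r p2)" using shortest_walk_avoids[OF p2 vw(2) le(2)] .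
  have q1: "awalk w1 (rev_path p1) r" using p1(1) by simp
  have q: "awalk w1 (rev_path p1 @ p2) w2" by (rule awalk_appendI[OF q1 p2(1)])
  have "v \<notin> set (awalk_verts w1 (rev_path p1 @ p2))"
    using set_awalk_verts_append[OF q1 p2(1)] awalk_verts_rev_path[OF p1(1)] a1 a2 by simp
  then have nq: "e \<in> set (rev_path p1 @ p2) \<Longrightarrow> fst e \<noteq> v \<and> snd e \<noteq> v" for e
    using set_awalk_verts[OF q] by force
  \<comment> \<open>The two shortest walks may share vertices. Shortening their concatenation to a
    path keeps only arcs already present, so \<open>v\<close> is still avoided.\<close>
  define p where "p = awalk_to_apath (rev_path p1 @ p2)"
  have p: "apath w1 p w2" unfolding p_def by (rule apath_awalk_to_apath[OF q])
  have walk: "awalk w1 p w2" using p by (rule awalkI_apath)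
  have "set p \<subseteq> set (rev_path p1 @ p2)" unfolding p_def by (rule awalk_to_apath_subset[OF q])
  then have nv: "v \<notin> set (awalk_verts w1 p)"
    using nq set_awalk_verts[OF walk] vw by fastforce
  have pne: "p \<noteq> []" using walk ne by (auto simp: awalk_Nil_iff)
  \<comment> \<open>This has at least 3 arcs, because \<open>w1 \<noteq> w2\<close> makes
    \<open>p\<close> nonempty; it is not the 2-cycle of a single edge.\<close>
  let ?c = "(v, w1) # p @ [(w2, v)]"
  have last: "awlast w1 p = w2" using walk by simp
  have pc: "awalk w1 (p @ [(w2, v)]) v"
    by (rule awalk_appendI[OF walk]) (use arcs_symmetric[OF w(2)] V in \<open>simp add: awalk_simps\<close>)
  have "awalk v ?c v" using pc w by (simp add: awalk_Cons_iff del: awalk_append_iff)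
  moreover have "awalk_verts w1 (p @ [(w2, v)]) = awalk_verts w1 p @ [v]"
    using awalk_verts_append[OF pc] last by simp
  then have "distinct (tl (awalk_verts v ?c))"
    using p nv by (simp add: apath_def)
  ultimately have "cycle ?c" unfolding cycle_def by blast
  then show False using no_long_cycle[of ?c] pne by (cases p) auto
qed

end

section \<open>Parity of distances and walks without backtracking\<close>

context tree_graph
begin

text \<open>Trees are bipartite: an arc inside a level of \<open>r\<close> would give
  \<open>u\<close>, besides its predecessor towards \<open>r\<close>, a second neighbour that is not
  farther than \<open>u\<close>.\<close>

lemma hop_arc_cases:
  assumes "r \<in> pverts G" "(u, v) \<in> parcs G"
  shows "hop r v = Suc (hop r u) \<or> hop r u = Suc (hop r v)"
proof -
  have V: "u \<in> pverts G" "v \<in> pverts G" using assms wellformed' by auto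
  have vu: "(v, u) \<in> parcs G" "u \<noteq> v" using assms arcs_symmetric no_loops' by auto
  have "hop r u \<le> hop r v + 1" "hop r v \<le> hop r u + 1"
    using hop_triangle[of r u v] hop_triangle[of r v u] hop_arc[OF assms(2)] hop_arc[OF vu(1)] assms V
    by auto
  moreover have "hop r u \<noteq> hop r v"
  proof
    assume eq: "hop r u = hop r v"
    show False
    proof (cases "r = u")
      case True
      then show False using eq hop_arc[OF assms(2)] V by simp
    next
      case False
      then obtain w where w: "(u, w) \<in> parcs G" "hop r u = Suc (hop r w)"
        by (rule hop_predecessor[OF assms(1) V(1)])
      then have "w = v" using eq by (intro unique_closer_neighbour[OF assms(1) _ assms(2)]) auto
      with w eq show False by simp
    qed
  qed
  ultimately show ?thesis by linarith
qed

text \<open>A walk through \<open>p 0\<close>, ..., \<open>p d\<close> that never turns straight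
  back; values of \<open>p\<close> beyond \<open>d\<close> are arbitrary. The condition is local,
  yet in a tree it makes the walk a geodesic, see \<open>track_hop\<close>.\<close>

definition track :: "(nat \<Rightarrow> 'a) \<Rightarrow> nat \<Rightarrow> bool" where
  "track p d \<longleftrightarrow> (\<forall>j\<le>d. p j \<in> pverts G) \<and> (\<forall>j<d. (p j, p (Suc j)) \<in> parcs G) \<and>
     (\<forall>j. Suc (Suc j) \<le> d \<longrightarrow> p j \<noteq> p (Suc (Suc j)))"

lemma track_rev:
  assumes "track p d"
  shows "track (\<lambda>j. p (d - j)) d"
  unfolding track_def
proof (intro conjI allI impI)
  fix j assume j: "j < d"
  then have "(p (d - Suc j), p (Suc (d - Suc j))) \<in> parcs G" using assms by (simp add: track_def)
  moreover have "Suc (d - Suc j) = d - j" using j by simp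
  ultimately show "(p (d - j), p (d - Suc j)) \<in> parcs G" by (simp add: arcs_symmetric)
next
  fix j assume j: "Suc (Suc j) \<le> d"
  then have "p (d - Suc (Suc j)) \<noteq> p (Suc (Suc (d - Suc (Suc j))))"
    using assms unfolding track_def by simp
  moreover have "Suc (Suc (d - Suc (Suc j))) = d - j" using j by simp
  ultimately show "p (d - j) \<noteq> p (d - Suc (Suc j))" by simp
qed (use assms in \<open>simp add: track_def\<close>)

text \<open>After a step away from \<open>r\<close>, the vertex just left is the only neighbour that
  is not farther, and turning back to it is forbidden, so the next step leads away again. The
  induction carries two consecutive distances because each step consults both.\<close>

lemma track_ascending:
  assumes p: "track p d" and r: "r \<in> pverts G" and min: "\<And>j. j \<le> d \<Longrightarrow> hop r (p i) \<le> hop r (p j)"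
  shows "(i + k \<le> d \<longrightarrow> hop r (p (i + k)) = hop r (p i) + k) \<and>
    (Suc (i + k) \<le> d \<longrightarrow> hop r (p (Suc (i + k))) = hop r (p i) + Suc k)"
proof (induction k)
  case 0
  show ?case
  proof (intro conjI impI)
    assume "Suc (i + 0) \<le> d"
    then have "(p i, p (Suc i)) \<in> parcs G" "hop r (p i) \<le> hop r (p (Suc i))"
      using p min by (auto simp: track_def)
    then show "hop r (p (Suc (i + 0))) = hop r (p i) + Suc 0" using hop_arc_cases[OF r, of "p i" "p (Suc i)"] by auto
  qed simp
next
  case (Suc k)
  let ?x = "p (i + k)" and ?y = "p (Suc (i + k))" and ?z = "p (Suc (Suc (i + k)))"
  show ?case
  proof (intro conjI impI)
    assume le: "Suc (i + Suc k) \<le> d"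
    then have y: "hop r ?y = Suc (hop r ?x)" and y': "hop r ?y = hop r (p i) + Suc k" using Suc by auto
    have arcs: "(?y, ?x) \<in> parcs G" "(?y, ?z) \<in> parcs G" and xz: "?x \<noteq> ?z"
      using p le by (auto simp: track_def arcs_symmetric)
    have "\<not> hop r ?z \<le> hop r ?y"
      using unique_closer_neighbour[OF r arcs] y xz by auto
    then have "hop r ?z = Suc (hop r ?y)" using hop_arc_cases[OF r arcs(2)] by auto
    then show "hop r (p (Suc (i + Suc k))) = hop r (p i) + Suc (Suc k)" using y' by simp
  qed (use Suc in simp)
qed

text \<open>Distances to the vertices of a track have no interior local maximum, since such a vertex
  would have two neighbours closer to \<open>r\<close>.\<close>

lemma track_gate:
  assumes p: "track p d" and r: "r \<in> pverts G"
  obtains i where "i \<le> d" "\<And>j. j \<le> d \<Longrightarrow> hop r (p j) = hop r (p i) + ((i - j) + (j - i))"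
proof -
  have "\<exists>i. i \<in> {..d} \<and> (\<forall>j. j \<in> {..d} \<longrightarrow> hop r (p i) \<le> hop r (p j))"
    using ex_has_least_nat[of "\<lambda>j. j \<in> {..d}" 0 "\<lambda>j. hop r (p j)"] by simp
  then obtain i where i: "i \<le> d" "\<And>j. j \<le> d \<Longrightarrow> hop r (p i) \<le> hop r (p j)" by auto
  have up: "hop r (p j) = hop r (p i) + (j - i)" if "i \<le> j" "j \<le> d" for j
    using track_ascending[OF p r i(2), of "j - i"] that by simp
  \<comment> \<open>The side before \<open>i\<close> is the ascending side of the reversed track,
    whose minimum sits at \<open>d - i\<close>.\<close>
  have down: "hop r (p j) = hop r (p i) + (i - j)" if "j \<le> i" for j
  proof -
    have "hop r (p (d - (d - i))) \<le> hop r (p (d - j))" if "j \<le> d" for j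
      using i that by simp
    from track_ascending[OF track_rev[OF p] r this, of "i - j"]
    show ?thesis using that i(1) by simp
  qed
  show ?thesis
  proof (rule that[OF i(1)])
    fix j assume "j \<le> d"
    then show "hop r (p j) = hop r (p i) + ((i - j) + (j - i))"
      using up[of j] down[of j] by (cases "i \<le> j") auto
  qed
qed

text \<open>The vertex \<open>p k\<close> is its own gate, as its distance 0 to itself leaves no
  room for another. In truncated subtraction \<open>(k - j) + (j - k)\<close> is the absolute
  difference.\<close>

lemma track_hop:
  assumes p: "track p d" and "k \<le> d" "j \<le> d"
  shows "hop (p k) (p j) = (k - j) + (j - k)"
proof -
  have V: "p k \<in> pverts G" using p assms by (simp add: track_def)
  obtain i where i: "i \<le> d" "\<And>j. j \<le> d \<Longrightarrow> hop (p k) (p j) = hop (p k) (p i) + ((i - j) + (j - i))"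
    using track_gate[OF p V] by blast
  have "hop (p k) (p i) + ((i - k) + (k - i)) = 0" using i(2)[OF assms(2)] V by simp
  then have "hop (p k) (p i) = 0" "i = k" by auto
  then show ?thesis using i(2)[OF assms(3)] by simp
qed

text \<open>Appending \<open>v\<close> to a track that ends in its predecessor does not turn back:
  the vertex before the predecessor is two levels closer to \<open>u\<close> than
  \<open>v\<close>.\<close>

lemma geodesic_track:
  "u \<in> pverts G \<Longrightarrow> v \<in> pverts G \<Longrightarrow> hop u v = d \<Longrightarrow> \<exists>p. track p d \<and> p 0 = u \<and> p d = v"
proof (induction d arbitrary: v)
  case 0
  then show ?case using hop_eq_0_iff[of u v] by (intro exI[of _ "\<lambda>_. u"]) (auto simp: track_def)
next
  case (Suc d)
  then have "u \<noteq> v" by auto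
  obtain w where w: "(v, w) \<in> parcs G" "hop u v = Suc (hop u w)"
    by (rule hop_predecessor[OF Suc.prems(1,2) \<open>u \<noteq> v\<close>])
  then have W: "w \<in> pverts G" "hop u w = d" using Suc.prems in_arcsD2 by auto
  then obtain p where p: "track p d" "p 0 = u" "p d = w" using Suc.IH[OF Suc.prems(1)] by blast
  have hv: "p (d - Suc 0) \<noteq> v" if "d > 0"
    using track_hop[OF p(1), of 0 "d - Suc 0"] p(2) Suc.prems(3) by auto
  have "track (p(Suc d := v)) (Suc d)"
    unfolding track_def
  proof (intro conjI allI impI)
    fix j assume "j < Suc d"
    then show "((p(Suc d := v)) j, (p(Suc d := v)) (Suc j)) \<in> parcs G"
      using p w by (cases "j = d") (auto simp: track_def arcs_symmetric)
  next
    fix j assume "Suc (Suc j) \<le> Suc d"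
    then show "(p(Suc d := v)) j \<noteq> (p(Suc d := v)) (Suc (Suc j))"
      using p hv by (cases "Suc j = d") (auto simp: track_def)
  qed (use p Suc.prems in \<open>auto simp: track_def\<close>)
  moreover have "(p(Suc d := v)) 0 = u" "(p(Suc d := v)) (Suc d) = v" using p(2) by auto
  ultimately show ?case by blast
qed

definition hop_ecc :: "'a \<Rightarrow> nat" where
  "hop_ecc u = Max (hop u ` pverts G)"

lemma hop_ecc_eqI:
  assumes "v \<in> pverts G" "hop u v = k" "\<And>w. w \<in> pverts G \<Longrightarrow> hop u w \<le> k"
  shows "hop_ecc u = k"
  unfolding hop_ecc_def using assms pair_finite_verts by (intro Max_eqI) auto

lemma eccentricity_hop:
  assumes "u \<in> pverts G"
  shows "eccentricity G u = real (hop_ecc u)"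
proof -
  have "gdist G u ` pverts G = real ` hop u ` pverts G"
    unfolding image_image using assms by (intro image_cong) (simp_all add: gdist_hop)
  then show ?thesis
    unfolding eccentricity_def hop_ecc_def using pair_finite_verts verts_nonempty
    by (simp add: mono_Max_commute[of real] mono_def)
qed

lemma ecc_entry_hop:
  assumes "u \<in> pverts G" "v \<in> pverts G"
  shows "ecc_entry G u v = (if hop u v = min (hop_ecc u) (hop_ecc v) then real (hop u v) else 0)"
  using assms by (simp add: ecc_entry_def gdist_hop eccentricity_hop flip: of_nat_min)

lemma ecc_entry_commute:
  assumes "u \<in> pverts G" "v \<in> pverts G"
  shows "ecc_entry G u v = ecc_entry G v u"
  using assms hop_commute[of u v] by (simp add: ecc_entry_hop min.commute)

end

section \<open>Gates on a diametral path\<close>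

locale diametral_track = tree_graph +
  fixes p :: "nat \<Rightarrow> 'a" and d :: nat
  assumes track: "track p d"
    and diameter: "u \<in> pverts G \<Longrightarrow> v \<in> pverts G \<Longrightarrow> hop u v \<le> d"
begin

lemma p_verts: "j \<le> d \<Longrightarrow> p j \<in> pverts G" using track by (simp add: track_def)

lemma p_inj: "j \<le> d \<Longrightarrow> k \<le> d \<Longrightarrow> p j = p k \<longleftrightarrow> j = k"
  using track_hop[OF track, of j k] hop_eq_0_iff[of "p j" "p k"] p_verts by auto

text \<open>Here \<open>p i\<close> is the point where \<open>u\<close> is attached to the track and
  \<open>a\<close> its height above it. The ends are at distances \<open>a + i\<close> and
  \<open>a + (d - i)\<close>; as neither exceeds \<open>d\<close>, the height is bounded by the
  distance from the gate to each end.\<close>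

lemma gate:
  assumes u: "u \<in> pverts G"
  obtains i a where "i \<le> d" "a \<le> i" "a \<le> d - i" "a = 0 \<longleftrightarrow> u = p i"
    "\<And>j. j \<le> d \<Longrightarrow> hop u (p j) = a + ((i - j) + (j - i))"
proof -
  obtain i where i: "i \<le> d" "\<And>j. j \<le> d \<Longrightarrow> hop u (p j) = hop u (p i) + ((i - j) + (j - i))"
    using track_gate[OF track u] by blast
  define a where "a = hop u (p i)"
  have a: "hop u (p j) = a + ((i - j) + (j - i))" if "j \<le> d" for j
    unfolding a_def by (rule i(2)[OF that])
  have "a \<le> i" "a \<le> d - i"
    using i(1) a[of 0] a[of d] diameter[OF u p_verts, of 0] diameter[OF u p_verts, of d] by auto
  moreover have "a = 0 \<longleftrightarrow> u = p i" unfolding a_def by (rule hop_eq_0_iff[OF u p_verts[OF i(1)]])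
  ultimately show ?thesis using that[OF i(1), of a] a by blast
qed

text \<open>The height of \<open>w\<close> over its gate \<open>p k\<close> is at most the distance
  from \<open>p k\<close> to either end. So from \<open>u\<close>, continuing along the track past
  \<open>p k\<close> to its end leads at least as far as branching off to \<open>w\<close>.\<close>

lemma hop_ecc_ends:
  assumes u: "u \<in> pverts G"
  shows "hop_ecc u = max (hop u (p 0)) (hop u (p d))"
proof -
  obtain i a where i: "i \<le> d" "a \<le> i" "a \<le> d - i"
    "\<And>j. j \<le> d \<Longrightarrow> hop u (p j) = a + ((i - j) + (j - i))"
    using gate[OF u] by metis
  have le: "hop u w \<le> max (hop u (p 0)) (hop u (p d))" if w: "w \<in> pverts G" for w
  proof -
    obtain k b where k: "k \<le> d" "b \<le> k" "b \<le> d - k"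
      "\<And>j. j \<le> d \<Longrightarrow> hop w (p j) = b + ((k - j) + (j - k))"
      using gate[OF w] by metis
    have "hop u w \<le> hop u (p k) + hop (p k) w" by (rule hop_triangle[OF u p_verts[OF k(1)] w])
    also have "hop (p k) w = b" using k(4)[OF k(1)] hop_commute[OF p_verts[OF k(1)] w] by simp
    finally show ?thesis using i(4)[OF k(1)] i(4)[of 0] i(4)[of d] i(1) k by auto
  qed
  show ?thesis
  proof (cases "hop u (p 0) \<le> hop u (p d)")
    case True
    then show ?thesis using le by (intro hop_ecc_eqI[of "p d"]) (auto simp: p_verts)
  next
    case False
    then show ?thesis using le by (intro hop_ecc_eqI[of "p 0"]) (auto simp: p_verts)
  qed
qed

end

section \<open>Eccentricities along a diametral path\<close>

context diametral_track
begin

lemma hop_ecc_p_ends: "hop_ecc (p 0) = d" "hop_ecc (p d) = d"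
  using hop_ecc_ends[OF p_verts, of 0] hop_ecc_ends[OF p_verts, of d]
    track_hop[OF track, of 0 d] track_hop[OF track, of d 0] p_verts[of 0] p_verts[of d] by auto

definition end_weight :: "'a \<Rightarrow> real" where
  "end_weight u = (ecc_entry G u (p 0))\<^sup>2 + (ecc_entry G u (p d))\<^sup>2"

text \<open>Both ends have the maximal eccentricity \<open>d\<close>, so the minimum in the entry is
  the eccentricity of \<open>u\<close>. The entry survives exactly in the column of a farthest end,
  and in both columns when the gate is the midpoint.\<close>

lemma end_weight_gate:
  assumes u: "u \<in> pverts G" and i: "i \<le> d" "\<And>j. j \<le> d \<Longrightarrow> hop u (p j) = a + ((i - j) + (j - i))"
  shows "end_weight u = (if d - i \<le> i then (real (a + i))\<^sup>2 else 0) + (if i \<le> d - i then (real (a + (d - i)))\<^sup>2 else 0)"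
proof -
  have h: "hop u (p 0) = a + i" "hop u (p d) = a + (d - i)" using i(2)[of 0] i(2)[of d] i(1) by auto
  have le: "a + i \<le> d" "a + (d - i) \<le> d"
    using diameter[OF u p_verts, of 0] diameter[OF u p_verts, of d] h by auto
  have ecc: "hop_ecc u = max (a + i) (a + (d - i))" using hop_ecc_ends[OF u] h by simp
  have "ecc_entry G u (p 0) = (if d - i \<le> i then real (a + i) else 0)"
    using ecc_entry_hop[OF u p_verts[of 0]] ecc h le hop_ecc_p_ends by (auto simp: max_def min_def)
  moreover have "ecc_entry G u (p d) = (if i \<le> d - i then real (a + (d - i)) else 0)"
    using ecc_entry_hop[OF u p_verts[of d]] ecc h le hop_ecc_p_ends by (auto simp: max_def min_def)
  ultimately show ?thesis unfolding end_weight_def by simp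
qed

text \<open>The larger of the two distances to the ends always survives as an entry, so a lower
  bound on either distance is enough.\<close>

lemma end_weight_ge:
  assumes u: "u \<in> pverts G" and i: "i \<le> d" "\<And>j. j \<le> d \<Longrightarrow> hop u (p j) = a + ((i - j) + (j - i))"
    and k: "k \<le> a + i \<or> k \<le> a + (d - i)"
  shows "(real k)\<^sup>2 \<le> end_weight u"
proof -
  have *: "end_weight u = (if d - i \<le> i then (real (a + i))\<^sup>2 else 0) + (if i \<le> d - i then (real (a + (d - i)))\<^sup>2 else 0)"
    by (rule end_weight_gate[OF u i])
  have "k \<le> a + i \<and> d - i \<le> i \<or> k \<le> a + (d - i) \<and> i \<le> d - i" using k by linarith
  then have "(real k)\<^sup>2 \<le> (real (a + i))\<^sup>2 \<and> d - i \<le> i \<or> (real k)\<^sup>2 \<le> (real (a + (d - i)))\<^sup>2 \<and> i \<le> d - i"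
    by (meson of_nat_0_le_iff of_nat_le_iff power_mono)
  moreover have "(if d - i \<le> i then (real (a + i))\<^sup>2 else 0) \<le> end_weight u"
    unfolding * by (rule le_add_same_cancel1[THEN iffD2]) simp
  moreover have "(if i \<le> d - i then (real (a + (d - i)))\<^sup>2 else 0) \<le> end_weight u"
    unfolding * by (rule le_add_same_cancel2[THEN iffD2]) simp
  ultimately show ?thesis by (elim disjE conjE) (simp_all only: if_True)
qed

text \<open>Both ends are farthest, hence the factor 2. At diameter 4 it matters: a single entry
  would give only 4 for the midpoint and 9 for a vertex at height 1 above it.\<close>

lemma end_weight_middle:
  assumes u: "u \<in> pverts G" and i: "i \<le> d" "\<And>j. j \<le> d \<Longrightarrow> hop u (p j) = a + ((i - j) + (j - i))"
    and "d = 2 * i"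
  shows "end_weight u = 2 * (real (a + i))\<^sup>2"
proof -
  have *: "end_weight u = (if d - i \<le> i then (real (a + i))\<^sup>2 else 0) + (if i \<le> d - i then (real (a + (d - i)))\<^sup>2 else 0)"
    by (rule end_weight_gate[OF u i])
  have "d - i = i" using assms(4) by simp
  then show ?thesis unfolding * by simp
qed

lemma end_weight_p:
  assumes "j \<le> d" "k \<le> j \<or> k \<le> d - j"
  shows "(real k)\<^sup>2 \<le> end_weight (p j)"
  by (rule end_weight_ge[OF p_verts[OF assms(1)] assms(1), of 0]) (use assms track_hop[OF track] in auto)

text \<open>Each entry between a vertex and an end occurs once in the row of the vertex and, by
  symmetry, once in the row of the end. The entry between the two ends is \<open>d\<close>.\<close>

lemma sum_end_weight_le:
  assumes d: "d > 0"
  shows "2 * ((real d)\<^sup>2 + (\<Sum>u\<in>pverts G - {p 0, p d}. end_weight u))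
    \<le> (\<Sum>u\<in>pverts G. \<Sum>v\<in>pverts G. (ecc_entry G u v)\<^sup>2)"
proof -
  define E where "E u v = (ecc_entry G u v)\<^sup>2" for u v
  define S where "S = pverts G - {p 0, p d}"
  have ne: "p 0 \<noteq> p d" using p_inj[of 0 d] d by auto
  have V: "pverts G = insert (p 0) (insert (p d) S)" using p_verts[of 0] p_verts[of d] by (auto simp: S_def)
  have fin: "finite S" using pair_finite_verts by (simp add: S_def)
  have nS: "p 0 \<notin> S" "p d \<notin> S" by (auto simp: S_def)
  have split: "(\<Sum>v\<in>pverts G. g v) = g (p 0) + g (p d) + (\<Sum>v\<in>S. g v)" for g :: "'a \<Rightarrow> real"
    unfolding V using fin nS ne by simp
  have nn: "0 \<le> E u v" for u v by (simp add: E_def)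
  have sym: "E (p 0) u = E u (p 0)" "E (p d) u = E u (p d)" if "u \<in> pverts G" for u
    unfolding E_def using ecc_entry_commute[OF that p_verts] by auto
  have corner: "E (p 0) (p d) = (real d)\<^sup>2"
    unfolding E_def using ecc_entry_hop[OF p_verts p_verts, of 0 d] hop_ecc_p_ends track_hop[OF track, of 0 d] by simp
  have row: "E u (p 0) + E u (p d) \<le> (\<Sum>v\<in>pverts G. E u v)" for u
    unfolding split using sum_nonneg[of S "E u"] nn by simp
  have "(\<Sum>u\<in>S. end_weight u) \<le> (\<Sum>u\<in>S. \<Sum>v\<in>pverts G. E u v)"
    using row unfolding end_weight_def E_def by (intro sum_mono) simp
  moreover have "(\<Sum>v\<in>pverts G. E (p 0) v) + (\<Sum>v\<in>pverts G. E (p d) v)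
      \<ge> 2 * (real d)\<^sup>2 + (\<Sum>u\<in>S. end_weight u)"
  proof -
    have "(\<Sum>v\<in>S. E (p 0) v) = (\<Sum>v\<in>S. E v (p 0))" "(\<Sum>v\<in>S. E (p d) v) = (\<Sum>v\<in>S. E v (p d))"
      by (intro sum.cong refl sym; simp add: S_def)+
    then have "(\<Sum>v\<in>S. E (p 0) v) + (\<Sum>v\<in>S. E (p d) v) = (\<Sum>u\<in>S. end_weight u)"
      by (simp add: end_weight_def E_def sum.distrib)
    then show ?thesis
      using corner sym(2)[OF p_verts[of 0]] nn[of "p 0" "p 0"] nn[of "p d" "p d"] unfolding split by simp
  qed
  ultimately have "2 * ((real d)\<^sup>2 + (\<Sum>u\<in>S. end_weight u)) \<le> (\<Sum>u\<in>pverts G. \<Sum>v\<in>pverts G. E u v)"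
    unfolding split[of "\<lambda>u. \<Sum>v\<in>pverts G. E u v"] by simp
  then show ?thesis by (simp add: E_def S_def)
qed

lemma sum_exceptional_ge:
  fixes g :: "'a \<Rightarrow> real"
  assumes "finite S" "X \<subseteq> S" "\<And>u. u \<in> S - X \<Longrightarrow> c \<le> g u"
  shows "(\<Sum>u\<in>X. g u) + c * (real (card S) - real (card X)) \<le> (\<Sum>u\<in>S. g u)"
proof -
  have "c * (real (card S) - real (card X)) = (\<Sum>u\<in>S - X. c)"
    using assms by (simp add: card_Diff_subset finite_subset card_mono of_nat_diff)
  also have "\<dots> \<le> (\<Sum>u\<in>S - X. g u)" using assms by (intro sum_mono) auto
  finally show ?thesis using sum.subset_diff[OF assms(2,1), of g] by simp
qed

text \<open>The path on five vertices attains the constant \<open>42 = 16 + 9 + 8 + 9\<close>; each further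
  vertex contributes at least 16.\<close>

lemma sum_ecc_entry_square_ge:
  assumes d: "d \<ge> 4"
  shows "2 * (42 + 16 * (real (card (pverts G)) - 5)) \<le> (\<Sum>u\<in>pverts G. \<Sum>v\<in>pverts G. (ecc_entry G u v)\<^sup>2)"
proof -
  define S where "S = pverts G - {p 0, p d}"
  have fin: "finite S" using pair_finite_verts by (simp add: S_def)
  have ne: "p 0 \<noteq> p d" using p_inj[of 0 d] d by auto
  have "card (pverts G) \<ge> 2"
    using card_mono[OF pair_finite_verts, of "{p 0, p d}"] ne p_verts[of 0] p_verts[of d] by auto
  then have cardS: "real (card S) = real (card (pverts G)) - 2"
    unfolding S_def using ne p_verts[of 0] p_verts[of d] pair_finite_verts by (simp add: card_Diff_subset)
  have pS: "p j \<in> S" if "0 < j" "j < d" for j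
    using that p_inj[of j 0] p_inj[of j d] p_verts[of j] by (auto simp: S_def)
  have "42 + 16 * (real (card (pverts G)) - 5) \<le> (real d)\<^sup>2 + (\<Sum>u\<in>S. end_weight u)"
  proof (cases "d = 4")
    case True
    \<comment> \<open>The inner vertices of the track weigh 9, 8 and 9, less than 16. Off the track,
      a gate \<open>p 1\<close> or \<open>p 3\<close> puts one end at distance 4, and a gate
      \<open>p 2\<close> gives two entries of at least 3, together at least 18.\<close>
    let ?X = "{p 1, p 2, p 3}"
    have ge16: "16 \<le> end_weight u" if u: "u \<in> S - ?X" for u
    proof -
      have uV: "u \<in> pverts G" using u by (simp add: S_def)
      obtain i a where i: "i \<le> d" "a \<le> i" "a \<le> d - i" "a = 0 \<longleftrightarrow> u = p i"
        "\<And>j. j \<le> d \<Longrightarrow> hop u (p j) = a + ((i - j) + (j - i))"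
        by (rule gate[OF uV]) (rule that)
      have "a \<noteq> 0"
      proof
        assume "a = 0"
        with i(4) have "u = p i" by simp
        moreover have "i = 0 \<or> i = 1 \<or> i = 2 \<or> i = 3 \<or> i = d" using i(1) True by linarith
        ultimately show False using u by (auto simp: S_def)
      qed
      show ?thesis
      proof (cases "i = 2")
        case i2: True
        have "end_weight u = 2 * (real (a + i))\<^sup>2"
          by (rule end_weight_middle[OF uV i(1) i(5)]) (use True i2 in auto)
        moreover have "(real 3)\<^sup>2 \<le> (real (a + i))\<^sup>2" using i2 \<open>a \<noteq> 0\<close> by (intro power_mono) auto
        ultimately show ?thesis by simp
      next
        case False
        have "(real 4)\<^sup>2 \<le> end_weight u"
          by (rule end_weight_ge[OF uV i(1) i(5)]) (use True False i(1) \<open>a \<noteq> 0\<close> in linarith)+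
        then show ?thesis by simp
      qed
    qed
    have X: "?X \<subseteq> S" "card ?X = 3" using pS True p_inj by auto
    have "end_weight (p 2) = 2 * (real (0 + 2))\<^sup>2"
      by (rule end_weight_middle) (use True p_verts track_hop[OF track] in auto)
    moreover have "(real 3)\<^sup>2 \<le> end_weight (p 1)" "(real 3)\<^sup>2 \<le> end_weight (p 3)"
      by (rule end_weight_p; use True in simp)+
    ultimately have "26 \<le> (\<Sum>u\<in>?X. end_weight u)" using p_inj True by simp
    then show ?thesis
      using sum_exceptional_ge[OF fin X(1), of 16 end_weight] ge16 X(2) cardS True by simp
  next
    case False
    then have d5: "d \<ge> 5" using d by simp
    \<comment> \<open>If both ends are closer than 4, then \<open>2 * a + d \<le> 6\<close>, so
      \<open>a = 0\<close> and the gate is \<open>p 2\<close> or \<open>p 3\<close>. With 25 for the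
      ends and 9 for each exception the total 25 + 18 + 16 (n - 4) exceeds what is required.\<close>
    let ?X = "{p 2, p 3}"
    have ge16: "16 \<le> end_weight u" if u: "u \<in> S - ?X" for u
    proof -
      have uV: "u \<in> pverts G" using u by (simp add: S_def)
      obtain i a where i: "i \<le> d" "a \<le> i" "a \<le> d - i" "a = 0 \<longleftrightarrow> u = p i"
        "\<And>j. j \<le> d \<Longrightarrow> hop u (p j) = a + ((i - j) + (j - i))"
        by (rule gate[OF uV]) (rule that)
      have "4 \<le> a + i \<or> 4 \<le> a + (d - i)"
      proof (rule ccontr)
        assume "\<not> ?thesis"
        then have "a = 0" "i = 2 \<or> i = 3" using d5 i(1) by linarith+
        with i(4) u show False by auto
      qed
      from end_weight_ge[OF uV i(1) i(5) this] show ?thesis by simp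
    qed
    have X: "?X \<subseteq> S" "card ?X = 2" using pS d5 p_inj by auto
    have "(real 3)\<^sup>2 \<le> end_weight (p 2)" "(real 3)\<^sup>2 \<le> end_weight (p 3)"
      by (rule end_weight_p; use d5 in simp)+
    then have "18 \<le> (\<Sum>u\<in>?X. end_weight u)" using p_inj[of 2 3] d5 by simp
    moreover have "5\<^sup>2 \<le> (real d)\<^sup>2" using d5 by (intro power_mono) auto
    ultimately show ?thesis
      using sum_exceptional_ge[OF fin X(1), of 16 end_weight] ge16 X(2) cardS by simp
  qed
  then show ?thesis using sum_end_weight_le d by (simp add: S_def)
qed

end

section \<open>Distances and matrix entries in stars and double stars\<close>

context tree_graph
begin

lemma diametral_trackE:
  obtains p d where "diametral_track G p d"
proof -
  define D where "D = (\<lambda>(u, v). hop u v) ` (pverts G \<times> pverts G)"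
  have D: "finite D" "D \<noteq> {}" using pair_finite_verts verts_nonempty by (auto simp: D_def)
  obtain u v where uv: "u \<in> pverts G" "v \<in> pverts G" "hop u v = Max D"
    using Max_in[OF D] by (auto simp: D_def)
  obtain p where "track p (Max D)" using geodesic_track[OF uv] by blast
  moreover have "hop u v \<le> Max D" if "u \<in> pverts G" "v \<in> pverts G" for u v
    using that by (intro Max_ge[OF D(1)]) (auto simp: D_def)
  ultimately have "diametral_track G p (Max D)" by unfold_locales auto
  then show ?thesis by (rule that)
qed

text \<open>By parity along the arc from \<open>c\<close> to \<open>v\<close>, the distance differs
  by one from \<open>hop u c = 1\<close>, and it is not 0.\<close>

lemma hop_2:
  assumes "(c, u) \<in> parcs G" "(c, v) \<in> parcs G" "u \<noteq> v"
  shows "hop u v = 2"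
proof -
  have V: "c \<in> pverts G" "u \<in> pverts G" "v \<in> pverts G" using assms wellformed' by auto
  have "hop u c = 1" using hop_arc assms(1) arcs_symmetric by blast
  then show ?thesis using hop_arc_cases[OF V(2) assms(2)] assms(3) hop_eq_0_iff[OF V(2,3)] by auto
qed

text \<open>At \<open>y\<close> the neighbour \<open>x\<close> is already the one closer to
  \<open>u\<close>, so the step to \<open>v\<close> must lead away.\<close>

lemma hop_3:
  assumes arcs: "(u, x) \<in> parcs G" "(x, y) \<in> parcs G" "(y, v) \<in> parcs G" and ne: "u \<noteq> y" "x \<noteq> v"
  shows "hop u v = 3"
proof -
  have V: "u \<in> pverts G" using arcs wellformed' by auto
  have 1: "hop u x = 1" and 2: "hop u y = 2"
    using hop_arc arcs(1) hop_2[of x u y] arcs(1,2) arcs_symmetric ne(1) by auto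
  have "\<not> hop u v \<le> hop u y"
    using unique_closer_neighbour[OF V arcs_symmetric[OF arcs(2)] arcs(3)] 1 2 ne(2) by auto
  then show ?thesis using hop_arc_cases[OF V arcs(3)] 2 by auto
qed

lemma ecc_entry_star:
  assumes c: "c \<in> pverts G" and star: "\<And>u. u \<in> pverts G \<Longrightarrow> u \<noteq> c \<Longrightarrow> (c, u) \<in> parcs G"
    and card: "2 \<le> card (pverts G)"
  shows "ecc_entry G c c = 0"
    and "u \<in> pverts G - {c} \<Longrightarrow> ecc_entry G c u = 1 \<and> ecc_entry G u c = 1"
    and "u \<in> pverts G - {c} \<Longrightarrow> v \<in> pverts G - {c} \<Longrightarrow> ecc_entry G u v = (if u = v then 0 else 2)"
proof -
  have hc: "hop c u = 1" if "u \<in> pverts G" "u \<noteq> c" for u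
    using hop_arc star that by blast
  have hc': "hop u c = 1" if "u \<in> pverts G" "u \<noteq> c" for u
    using hc[OF that] hop_commute[OF c that(1)] by simp
  have hl: "hop u v = 2" if "u \<in> pverts G" "u \<noteq> c" "v \<in> pverts G" "v \<noteq> c" "u \<noteq> v" for u v
    using hop_2[of c] star that by blast
  have "pverts G \<noteq> {c}" using card by auto
  then obtain u0 where u0: "u0 \<in> pverts G" "u0 \<noteq> c" using c by blast
  have hle: "hop c w \<le> 1" if "w \<in> pverts G" for w using hc[OF that] c by (cases "w = c") auto
  have ec: "hop_ecc c = 1"
    using hop_ecc_eqI[OF u0(1) hc[OF u0]] hle by blast
  \<comment> \<open>With two vertices the only leaf has eccentricity 1 instead of 2. The lower bound
    covers both cases and suffices, since the minimum is taken with
    \<open>hop_ecc c = 1\<close>.\<close>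
  have eu1: "1 \<le> hop_ecc u" if "u \<in> pverts G" "u \<noteq> c" for u
    unfolding hop_ecc_def using hc'[OF that] c pair_finite_verts by (intro Max_ge) (auto intro: rev_image_eqI)
  have eu2: "hop_ecc u = 2" if "u \<in> pverts G" "u \<noteq> c" "v \<in> pverts G" "v \<noteq> c" "u \<noteq> v" for u v
  proof (rule hop_ecc_eqI[OF that(3) hl[OF that]])
    fix w assume "w \<in> pverts G"
    then show "hop u w \<le> 2" using hl[of u w] hc'[of u] that by (cases "w = c"; cases "w = u") auto
  qed
  show "ecc_entry G c c = 0" using ecc_entry_hop[OF c c] c by simp
  show "ecc_entry G c u = 1 \<and> ecc_entry G u c = 1" if u: "u \<in> pverts G - {c}"
    using u ecc_entry_hop[OF c, of u] ecc_entry_commute[OF c, of u] hc[of u] ec eu1[of u] by auto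
  show "ecc_entry G u v = (if u = v then 0 else 2)" if "u \<in> pverts G - {c}" "v \<in> pverts G - {c}"
    using that ecc_entry_hop[of u v] hl[of u v] eu2[of u v] eu2[of v u] by auto
qed

text \<open>Further arcs are not excluded explicitly: in a tree they would close a cycle with the
  listed ones.\<close>

definition double_star :: "'a \<Rightarrow> 'a \<Rightarrow> 'a set \<Rightarrow> 'a set \<Rightarrow> bool" where
  "double_star x y A B \<longleftrightarrow> (x, y) \<in> parcs G \<and> pverts G = insert x A \<union> insert y B \<and>
     insert x A \<inter> insert y B = {} \<and> x \<notin> A \<and> y \<notin> B \<and> A \<noteq> {} \<and> B \<noteq> {} \<and>
     (\<forall>u\<in>A. (x, u) \<in> parcs G) \<and> (\<forall>u\<in>B. (y, u) \<in> parcs G)"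

lemma double_star_commute: "double_star x y A B \<Longrightarrow> double_star y x B A"
  unfolding double_star_def by (auto intro: arcs_symmetric)

lemma double_star_hop:
  assumes ds: "double_star x y A B"
  shows "hop x y = 1"
    and "u \<in> A \<Longrightarrow> hop u x = 1" and "u \<in> A \<Longrightarrow> hop x u = 1" and "u \<in> A \<Longrightarrow> hop u y = 2"
    and "u \<in> A \<Longrightarrow> hop y u = 2"
    and "u \<in> A \<Longrightarrow> v \<in> A \<Longrightarrow> hop u v = (if u = v then 0 else 2)"
    and "u \<in> A \<Longrightarrow> v \<in> B \<Longrightarrow> hop u v = 3"
proof -
  note D = ds[unfolded double_star_def]
  have xy: "(x, y) \<in> parcs G" using D by blast
  have xu: "(x, u) \<in> parcs G" "u \<in> pverts G" "u \<noteq> x" "u \<noteq> y" "u \<notin> B" if "u \<in> A" for u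
    using D that by auto
  have yu: "(y, u) \<in> parcs G" "u \<in> pverts G" "u \<noteq> x" "u \<noteq> y" if "u \<in> B" for u
    using D that by auto
  show "hop x y = 1" by (rule hop_arc[OF xy])
  show "hop u x = 1" "hop x u = 1" "hop u y = 2" "hop y u = 2" if "u \<in> A"
    using hop_arc[OF xu(1)[OF that]] hop_arc[OF arcs_symmetric[OF xu(1)[OF that]]]
      hop_2[OF xu(1)[OF that] xy] hop_2[OF xy xu(1)[OF that]] xu[OF that] by auto
  show "hop u v = (if u = v then 0 else 2)" if "u \<in> A" "v \<in> A"
    using hop_2[of x u v] xu that by auto
  show "hop u v = 3" if "u \<in> A" "v \<in> B"
    using that xu[of u] yu[of v] xy by (intro hop_3[of u x y v]) (auto intro: arcs_symmetric)
qed

lemma double_star_ecc: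
  assumes ds: "double_star x y A B"
  shows "hop_ecc x = 2" and "u \<in> A \<Longrightarrow> hop_ecc u = 3"
proof -
  note D = ds[unfolded double_star_def]
  note ds' = double_star_commute[OF ds]
  note h = double_star_hop[OF ds] and h' = double_star_hop[OF ds']
  have V: "x \<in> pverts G" "y \<in> pverts G" using D by auto
  obtain b where b: "b \<in> B" "b \<in> pverts G" using D by blast
  show "hop_ecc x = 2"
  proof (rule hop_ecc_eqI[OF b(2) h'(5)[OF b(1)]])
    fix w assume "w \<in> pverts G"
    then have "w = x \<or> w = y \<or> w \<in> A \<or> w \<in> B" using D by auto
    then show "hop x w \<le> 2" using h(1) h(3)[of w] h'(5)[of w] V by auto
  qed
  show "hop_ecc u = 3" if u: "u \<in> A"
  proof (rule hop_ecc_eqI[OF b(2) h(7)[OF u b(1)]])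
    fix w assume "w \<in> pverts G"
    then have "w = x \<or> w = y \<or> w \<in> A \<or> w \<in> B" using D by auto
    then show "hop u w \<le> 3" using h(2)[OF u] h(4)[OF u] h(6)[OF u, of w] h(7)[OF u, of w] by auto
  qed
qed

lemma double_star_ecc_entry:
  assumes ds: "double_star x y A B"
  shows "u \<in> insert x A \<Longrightarrow> v \<in> insert x A \<Longrightarrow> ecc_entry G u v = 0"
    and "ecc_entry G x y = 0"
    and "u \<in> A \<Longrightarrow> ecc_entry G u y = 2" and "u \<in> A \<Longrightarrow> ecc_entry G y u = 2"
    and "u \<in> A \<Longrightarrow> v \<in> B \<Longrightarrow> ecc_entry G u v = 3"
    and "u \<in> A \<Longrightarrow> v \<in> B \<Longrightarrow> ecc_entry G v u = 3"
proof -
  note D = ds[unfolded double_star_def]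
  note ds' = double_star_commute[OF ds]
  note h = double_star_hop[OF ds] and h' = double_star_hop[OF ds']
  note e = double_star_ecc[OF ds] and e' = double_star_ecc[OF ds']
  have V: "x \<in> pverts G" "y \<in> pverts G" "\<And>u. u \<in> A \<Longrightarrow> u \<in> pverts G" "\<And>u. u \<in> B \<Longrightarrow> u \<in> pverts G"
    using D by auto
  show "ecc_entry G u v = 0" if "u \<in> insert x A" "v \<in> insert x A"
    using that ecc_entry_hop[of u v] V h(2)[of u] h(3)[of v] h(6)[of u v] e(1) e(2)[of u] e(2)[of v] by auto
  show "ecc_entry G x y = 0" using ecc_entry_hop[OF V(1,2)] h(1) e(1) e'(1) by simp
  show "ecc_entry G u y = 2" if u: "u \<in> A" using ecc_entry_hop[OF V(3)[OF u] V(2)] h(4)[OF u] e(2)[OF u] e'(1) by simp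
  then show "ecc_entry G y u = 2" if u: "u \<in> A" using ecc_entry_commute[OF V(3)[OF u] V(2)] u by simp
  show "ecc_entry G u v = 3" if u: "u \<in> A" "v \<in> B"
    using ecc_entry_hop[OF V(3)[OF u(1)] V(4)[OF u(2)]] h(7)[OF u] e(2)[OF u(1)] e'(2)[OF u(2)] by simp
  then show "ecc_entry G v u = 3" if u: "u \<in> A" "v \<in> B"
    using ecc_entry_commute[OF V(3)[OF u(1)] V(4)[OF u(2)]] u by simp
qed

end

section \<open>Trees of diameter at most 3\<close>

context diametral_track
begin

text \<open>The height bounds leave only vertices at height 1 above the centre and track vertices
  next to it. For \<open>d = 1\<close> the end \<open>p 0\<close> plays the centre.\<close>

lemma diameter_le_2_star:
  assumes d: "d \<le> 2" and u: "u \<in> pverts G" "u \<noteq> p (d div 2)"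
  shows "(p (d div 2), u) \<in> parcs G"
proof -
  obtain i a where i: "i \<le> d" "a \<le> i" "a \<le> d - i" "a = 0 \<longleftrightarrow> u = p i"
    "\<And>j. j \<le> d \<Longrightarrow> hop u (p j) = a + ((i - j) + (j - i))"
    by (rule gate[OF u(1)]) (rule that)
  have "i \<noteq> d div 2 \<or> a \<noteq> 0" using i(4) u(2) by auto
  then have "a + ((i - d div 2) + (d div 2 - i)) = 1" using i(1-3) d
    by (cases "d = 0"; cases "d = 1"; cases "d = 2") auto
  then have "hop u (p (d div 2)) = 1" using i(5)[of "d div 2"] by simp
  then show ?thesis using hop_1_iff[OF u(1) p_verts] arcs_symmetric by simp
qed

text \<open>Only the gates \<open>p 1\<close> and \<open>p 2\<close> allow a positive height, namely
  1, so every other vertex is adjacent to one of them. Parity excludes a common neighbour.\<close>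

lemma diameter_3_double_star:
  assumes d: "d = 3"
  shows "double_star (p 1) (p 2) {u \<in> pverts G - {p 1, p 2}. (p 1, u) \<in> parcs G}
    {u \<in> pverts G - {p 1, p 2}. (p 2, u) \<in> parcs G}"
proof -
  have arcs: "(p 0, p 1) \<in> parcs G" "(p 1, p 2) \<in> parcs G" "(p 2, p 3) \<in> parcs G"
    using track d by (auto simp: track_def numeral_2_eq_2 numeral_3_eq_3)
  have V: "p 0 \<in> pverts G" "p 1 \<in> pverts G" "p 2 \<in> pverts G" "p 3 \<in> pverts G" using p_verts d by auto
  have ne: "p 0 \<noteq> p 1" "p 0 \<noteq> p 2" "p 3 \<noteq> p 1" "p 3 \<noteq> p 2" "p 1 \<noteq> p 2" using p_inj d by auto
  have cover: "(p 1, u) \<in> parcs G \<or> (p 2, u) \<in> parcs G" if u: "u \<in> pverts G" "u \<noteq> p 1" "u \<noteq> p 2" for u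
  proof -
    obtain i a where i: "i \<le> d" "a \<le> i" "a \<le> d - i" "a = 0 \<longleftrightarrow> u = p i"
      "\<And>j. j \<le> d \<Longrightarrow> hop u (p j) = a + ((i - j) + (j - i))"
      by (rule gate[OF u(1)]) (rule that)
    have "i = 0 \<or> i = 1 \<or> i = 2 \<or> i = 3" using i(1) d by linarith
    moreover have "i = 1 \<or> i = 2 \<Longrightarrow> a = 1" using i(2-4) u(2,3) d by auto
    ultimately have "hop u (p 1) = 1 \<or> hop u (p 2) = 1"
      using i(5)[of 1] i(5)[of 2] i(2,3) d by auto
    then show ?thesis using hop_1_iff[OF u(1) V(2)] hop_1_iff[OF u(1) V(3)] arcs_symmetric by auto
  qed
  have excl: "\<not> ((p 1, u) \<in> parcs G \<and> (p 2, u) \<in> parcs G)" for u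
  proof
    assume "(p 1, u) \<in> parcs G \<and> (p 2, u) \<in> parcs G"
    then show False using hop_arc_cases[OF V(2), of "p 2" u] hop_arc arcs(2) by auto
  qed
  have "p 0 \<in> {u \<in> pverts G - {p 1, p 2}. (p 1, u) \<in> parcs G}"
    "p 3 \<in> {u \<in> pverts G - {p 1, p 2}. (p 2, u) \<in> parcs G}"
    using V ne arcs arcs_symmetric by auto
  then show ?thesis
    unfolding double_star_def using arcs(2) V ne cover excl by auto
qed

end

section \<open>Stars and double stars as trees\<close>

text \<open>Index form of the chaining condition, needed to compare an arc of a cycle with its two
  cyclic neighbours.\<close>

lemma pcas_iff_nth:
  assumes "pcas u c v" "c \<noteq> []"
  shows "fst (c ! 0) = u" "snd (c ! (length c - 1)) = v" "Suc i < length c \<Longrightarrow> snd (c ! i) = fst (c ! Suc i)"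
proof -
  have "fst (c ! 0) = u \<and> snd (c ! (length c - 1)) = v \<and> (\<forall>i. Suc i < length c \<longrightarrow> snd (c ! i) = fst (c ! Suc i))"
    using assms
  proof (induction c arbitrary: u)
    case (Cons e es)
    show ?case
    proof (cases "es = []")
      case False
      then have "fst (es ! 0) = snd e \<and> snd (es ! (length es - 1)) = v \<and>
          (\<forall>i. Suc i < length es \<longrightarrow> snd (es ! i) = fst (es ! Suc i))"
        using Cons.IH[of "snd e"] Cons.prems False by simp
      then show ?thesis using Cons.prems False by (auto simp: nth_Cons split: nat.splits)
    qed (use Cons.prems in simp)
  qed simp
  then show "fst (c ! 0) = u" "snd (c ! (length c - 1)) = v" "Suc i < length c \<Longrightarrow> snd (c ! i) = fst (c ! Suc i)"
    by auto
qed

text \<open>On a cycle of length at least 3, a vertex of maximal rank would have two distinct neighbours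
  of at most its own rank.\<close>

lemma is_tree_rankI:
  fixes h :: "'a \<Rightarrow> nat"
  assumes G: "pair_graph G" and r: "r \<in> pverts G"
    and down: "\<And>v. v \<in> pverts G \<Longrightarrow> v \<noteq> r \<Longrightarrow> \<exists>w. (v, w) \<in> parcs G \<and> h w < h v"
    and uniq: "\<And>v w w'. (v, w) \<in> parcs G \<Longrightarrow> (v, w') \<in> parcs G \<Longrightarrow> h w \<le> h v \<Longrightarrow> h w' \<le> h v \<Longrightarrow> w = w'"
  shows "is_tree G"
proof -
  interpret pair_graph G by (rule G)
  have to_r: "v \<rightarrow>\<^sup>*\<^bsub>with_proj G\<^esub> r" if "v \<in> pverts G" for v
    using that
  proof (induction "h v" arbitrary: v rule: less_induct)
    case less
    show ?case
    proof (cases "v = r")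
      case False
      then obtain w where w: "(v, w) \<in> parcs G" "h w < h v" using down[OF less.prems] by blast
      then have "w \<rightarrow>\<^sup>*\<^bsub>with_proj G\<^esub> r" using less.hyps in_arcsD2 by blast
      with w(1) show ?thesis by (rule adj_reachable_trans)
    qed (use r in simp)
  qed
  have "strongly_connected (with_proj (mk_symmetric (with_proj G)))"
  proof
    show "verts (with_proj (mk_symmetric (with_proj G))) \<noteq> {}" using r by auto
    fix u v assume "u \<in> verts (with_proj (mk_symmetric (with_proj G)))"
      "v \<in> verts (with_proj (mk_symmetric (with_proj G)))"
    then have "u \<rightarrow>\<^sup>*\<^bsub>with_proj G\<^esub> r" "r \<rightarrow>\<^sup>*\<^bsub>with_proj G\<^esub> v"
      using to_r symmetric_reachable[OF sym_arcs] by auto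
    then have "u \<rightarrow>\<^sup>*\<^bsub>with_proj G\<^esub> v" by (rule reachable_trans)
    then show "u \<rightarrow>\<^sup>*\<^bsub>with_proj (mk_symmetric (with_proj G))\<^esub> v"
      by (rule reachable_mk_symmetricI)
  qed
  then have conn: "connected (with_proj G)" by (simp add: connected_def)
  have False if cyc: "cycle c" "3 \<le> length c" for c
  proof -
    obtain u where u: "awalk u c u" "distinct (tl (pawalk_verts u c))" "c \<noteq> []"
      using cyc(1) unfolding cycle_def by blast
    define n where "n = length c"
    have cas: "pcas u c u" and sub: "set c \<subseteq> parcs G" using u(1) by auto
    have dist: "distinct (map snd c)" using u awalk_verts_conv'[OF cas] by simp
    note nth = pcas_iff_nth[OF cas u(3)]
    have "\<exists>i. i < n \<and> (\<forall>j. j < n \<longrightarrow> h (snd (c ! j)) \<le> h (snd (c ! i)))"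
    proof -
      define H where "H = (\<lambda>i. h (snd (c ! i))) ` {..<n}"
      have H: "finite H" "H \<noteq> {}" using u(3) by (auto simp: H_def n_def)
      obtain i where "i < n" "Max H = h (snd (c ! i))" using Max_in[OF H] by (auto simp: H_def)
      moreover have "h (snd (c ! j)) \<le> Max H" if "j < n" for j
        using that by (intro Max_ge[OF H(1)]) (auto simp: H_def)
      ultimately show ?thesis by auto
    qed
    then obtain i where i: "i < n" "\<And>j. j < n \<Longrightarrow> h (snd (c ! j)) \<le> h (snd (c ! i))" by blast
    \<comment> \<open>Cyclic predecessor and successor of \<open>i\<close>. They differ because
      there are at least 3 arcs; on the 2-cycle of an edge they would coincide.\<close>
    define k where "k = (if i = 0 then n - 1 else i - 1)"
    define j where "j = (if i = n - 1 then 0 else Suc i)"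
    have kj: "k < n" "j < n" "k \<noteq> j" using i(1) cyc(2) unfolding k_def j_def n_def by auto
    have 1: "fst (c ! i) = snd (c ! k)"
      using nth(1,2) nth(3)[of "i - 1"] i(1) unfolding k_def n_def by auto
    have 2: "fst (c ! j) = snd (c ! i)"
      using nth(1,2) nth(3)[of i] i(1) unfolding j_def n_def by (auto simp: less_diff_conv)
    have "c ! i \<in> parcs G" "c ! j \<in> parcs G" using sub i(1) kj(2) unfolding n_def by auto
    then have "(snd (c ! k), snd (c ! i)) \<in> parcs G" "(snd (c ! i), snd (c ! j)) \<in> parcs G"
      using 1 2 by (metis prod.collapse)+
    then have "snd (c ! k) = snd (c ! j)"
      using uniq[of "snd (c ! i)" "snd (c ! k)" "snd (c ! j)"] i(2) kj arcs_symmetric by blast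
    then show False using dist kj unfolding n_def by (simp add: distinct_conv_nth)
  qed
  with conn G show ?thesis unfolding is_tree_def by blast
qed

section \<open>The two candidate trees\<close>

lemma star_arcs: "parcs (star n) = {0} \<times> {1..<n} \<union> {1..<n} \<times> {0}"
  by (auto simp: star_def symcl_def)

lemma star_verts: "pverts (star n) = {..<n}"
  by (simp add: star_def)

lemma star_tree:
  assumes "n \<ge> 1"
  shows "tree_on n (star n)"
proof -
  have "graph (with_proj (star n))"
    using star_complete_bipartite[OF assms] by (simp add: complete_bipartite_digraph_def)
  then have "pair_graph (star n)" by (rule pair_graphI_graph)
  then have "is_tree (star n)"
  proof (rule is_tree_rankI[where r = 0 and h = "\<lambda>i. if i = 0 then 0 else 1"])
    fix v assume "v \<in> pverts (star n)" "v \<noteq> 0"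
    then show "\<exists>w. (v, w) \<in> parcs (star n) \<and> (if w = 0 then 0 else 1) < (if v = 0 then 0 else (1::nat))"
      by (intro exI[of _ 0]) (simp add: star_arcs star_verts)
  qed (use assms in \<open>auto simp: star_arcs star_verts split: if_splits\<close>)
  then show ?thesis by (simp add: tree_on_def star_def)
qed

text \<open>The path end 3 is one more pendant vertex at 2. This exhibits a double star with centres
  1 and 2 and leaf sets \<open>{0}\<close> and \<open>{3..<n}\<close>.\<close>

lemma T3_arcs:
  assumes "n \<ge> 4"
  shows "parcs (T3 n) = {(0, 1), (1, 0), (1, 2), (2, 1)} \<union> {2} \<times> {3..<n} \<union> {3..<n} \<times> {2}"
  using assms by (auto simp: T3_def symcl_def)

lemma T3_tree:
  assumes n: "n \<ge> 4"
  shows "tree_on n (T3 n)"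
proof -
  have V: "pverts (T3 n) = {..<n}" by (simp add: T3_def)
  have "pair_graph (T3 n)"
    by unfold_locales (use n in \<open>auto simp: V T3_arcs[OF n] symmetric_def sym_def\<close>)
  then have "is_tree (T3 n)"
  \<comment> \<open>The rank is the distance to the root 2.\<close>
  proof (rule is_tree_rankI[where r = 2 and h = "\<lambda>i. if i = 2 then 0 else if i = 0 then 2 else 1"])
    fix v assume "v \<in> pverts (T3 n)" "v \<noteq> 2"
    then show "\<exists>w. (v, w) \<in> parcs (T3 n) \<and> (if w = 2 then 0 else if w = 0 then 2 else 1)
        < (if v = 2 then 0 else if v = 0 then 2 else (1::nat))"
      using n by (intro exI[of _ "if v = 0 then 1 else 2"]) (auto simp: V T3_arcs)
  qed (use n in \<open>auto simp: V T3_arcs split: if_splits\<close>)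
  then show ?thesis by (simp add: tree_on_def V)
qed

section \<open>Comparison of energies\<close>

lemma tree_graphI: "is_tree G \<Longrightarrow> tree_graph G"
  by (simp add: tree_graph_def tree_graph_axioms_def is_tree_def)

context tree_graph
begin

lemma vertex_list: "distinct (vertex_list G)" "set (vertex_list G) = pverts G"
proof -
  have "\<exists>vs. distinct vs \<and> set vs = pverts G"
    using finite_distinct_list[OF pair_finite_verts] by blast
  then have "distinct (vertex_list G) \<and> set (vertex_list G) = pverts G"
    unfolding vertex_list_def by (rule someI_ex)
  then show "distinct (vertex_list G)" "set (vertex_list G) = pverts G" by auto
qed

lemma ecc_energy_kernel: "ecc_energy G = kernel_energy (vertex_list G) (ecc_entry G)"
proof -
  have "card (pverts G) = length (vertex_list G)" using vertex_list distinct_card by metis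
  then show ?thesis
    by (simp add: ecc_energy_def ecc_eigenvalues_def ecc_matrix_def kernel_energy_def
      kernel_spectrum_def kernel_matrix_def)
qed

definition star_centre :: "'a \<Rightarrow> bool" where
  "star_centre c \<longleftrightarrow> c \<in> pverts G \<and> (\<forall>u\<in>pverts G - {c}. (c, u) \<in> parcs G)"

lemma ecc_energy_star:
  assumes c: "star_centre c" and n: "card (pverts G) = n" "2 \<le> n"
  shows "ecc_energy G = 2 * (real n - 2) + 2 * sqrt ((real n - 2)\<^sup>2 + (real n - 2) + 1)"
proof -
  have cV: "c \<in> pverts G" and arcs: "\<And>u. u \<in> pverts G \<Longrightarrow> u \<noteq> c \<Longrightarrow> (c, u) \<in> parcs G"
    using c by (auto simp: star_centre_def)
  note e = ecc_entry_star[OF cV arcs]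
  have card: "card (pverts G - {c}) = n - 1" using cV n(1) pair_finite_verts by simp
  have "ecc_energy G = 2 * (real (n - 1) - 1) + 2 * sqrt ((real (n - 1))\<^sup>2 - real (n - 1) + 1)"
    unfolding ecc_energy_kernel card[symmetric]
  proof (rule kernel_energy_star[where c = c])
    show "pverts G - {c} \<noteq> {}" using card n by (metis One_nat_def card.empty diff_is_0_eq not_less_eq_eq numeral_2_eq_2)
  qed (use vertex_list cV e n in \<open>auto simp: insert_absorb\<close>)
  also have "real (n - 1) = (real n - 2) + 1" using n by simp
  finally show ?thesis using n by (simp add: power2_eq_square algebra_simps)
qed

lemma ecc_energy_double_star:
  assumes ds: "double_star x y A B"
  shows "ecc_energy G = 2 * sqrt (9 * real (card A) * real (card B) + 4 * (real (card A) + card B) + 8 * sqrt (real (card A) * real (card B)))"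
proof -
  note D = ds[unfolded double_star_def]
  note e = double_star_ecc_entry[OF ds] double_star_ecc_entry[OF double_star_commute[OF ds]]
  have set: "set (vertex_list G) = insert x A \<union> insert y B" using D vertex_list(2) by simp
  have disj: "insert x A \<inter> insert y B = {}" "x \<notin> A" "y \<notin> B" "A \<noteq> {}" "B \<noteq> {}" using D by blast+
  have "kernel_energy (vertex_list G) (ecc_entry G)
      = 2 * sqrt (9 * real (card A) * real (card B) + 4 * (real (card A) + real (card B))
        + 8 * sqrt (real (card A) * real (card B)))"
    by (rule kernel_energy_double_star[OF vertex_list(1) set disj
      e(1) e(7) e(2) e(8) e(3) e(4) e(9) e(10) e(5) e(6)])
  then show ?thesis unfolding ecc_energy_kernel by (simp only: of_nat_mult of_nat_numeral of_nat_add)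
qed

lemma ecc_energy_square_ge:
  "2 * (\<Sum>u\<in>pverts G. \<Sum>v\<in>pverts G. (ecc_entry G u v)\<^sup>2) \<le> (ecc_energy G)\<^sup>2"
proof -
  interpret symmetric_kernel "vertex_list G" "ecc_entry G"
    by unfold_locales (use vertex_list ecc_entry_commute in auto)
  have "ecc_entry G v v = 0" if "v \<in> pverts G" for v
    using ecc_entry_hop[OF that that] that by simp
  then show ?thesis using energy_square_ge unfolding ecc_energy_kernel vertex_list by simp
qed

lemma ecc_energy_nonneg: "0 \<le> ecc_energy G"
proof -
  have "0 \<le> (\<Sum>\<xi>\<in>#E. \<bar>\<xi>\<bar>)" for E :: "real multiset" by (induction E) auto
  then show ?thesis by (simp add: ecc_energy_def)
qed

text \<open>Through a star centre any two vertices are within distance 2, but leaves at different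
  centres of a double star are at distance 3. This separates the path on four vertices from the
  star.\<close>

lemma double_star_not_star:
  assumes ds: "double_star x y A B"
  shows "\<not> star_centre c"
proof
  assume c: "star_centre c"
  have "A \<noteq> {}" "B \<noteq> {}" and V: "pverts G = insert x A \<union> insert y B"
    using ds by (simp_all add: double_star_def)
  then obtain u v where "u \<in> A" "v \<in> B" by blast
  with V have uv: "u \<in> A" "v \<in> B" "u \<in> pverts G" "v \<in> pverts G" by auto
  have cV: "c \<in> pverts G" using c by (simp add: star_centre_def)
  have "hop c w \<le> 1" if "w \<in> pverts G" for w
    using c hop_arc[of c w] that by (cases "w = c") (auto simp: star_centre_def)
  then have "hop u v \<le> 1 + 1"
    using hop_triangle[OF uv(3) cV uv(4)] hop_commute[OF uv(3) cV] uv(3,4) by (metis add_mono le_trans)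
  then show False using double_star_hop(7)[OF ds uv(1,2)] by simp
qed

lemma double_star_card:
  assumes ds: "double_star x y A B"
  shows "card (pverts G) = card A + card B + 2" "card A \<ge> 1" "card B \<ge> 1"
proof -
  note D = ds[unfolded double_star_def]
  have fin: "finite A" "finite B" using D pair_finite_verts by (metis finite_Un finite_insert)+
  then show "card (pverts G) = card A + card B + 2"
    using D by (simp add: card_Un_disjoint)
  show "card A \<ge> 1" "card B \<ge> 1" using D fin by (simp_all add: Suc_leI card_gt_0_iff)
qed

lemma tree_shape_cases:
  obtains (star) c where "star_centre c"
  | (double) x y A B where "double_star x y A B"
  | (long) p d where "diametral_track G p d" "d \<ge> 4"
proof -
  obtain p d where pd: "diametral_track G p d" by (rule diametral_trackE)
  then interpret diametral_track G p d .
  have "d \<le> 2 \<or> d = 3 \<or> d \<ge> 4" by linarith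
  then show ?thesis
  proof (elim disjE)
    assume "d \<le> 2"
    then have "star_centre (p (d div 2))"
      using diameter_le_2_star p_verts by (auto simp: star_centre_def)
    then show ?thesis by (rule star)
  qed (use diameter_3_double_star double long pd in blast)+
qed

text \<open>The \<open>d + 1\<close> track vertices are distinct. With at most 4 vertices this rules
  out diameter 4 or more.\<close>

lemma long_card:
  assumes "diametral_track G p d"
  shows "d < card (pverts G)"
proof -
  interpret diametral_track G p d by (rule assms)
  have "card (p ` {..d}) \<le> card (pverts G)"
    using p_verts pair_finite_verts by (intro card_mono) auto
  moreover have "card (p ` {..d}) = Suc d"
    using p_inj by (subst card_image) (auto simp: inj_on_def)
  ultimately show ?thesis by simp
qed

end

section \<open>Numerical comparison with the energy of \<open>T3 n\<close>\<close>

text \<open>The double star formula with 1 and \<open>n - 3\<close> leaves.\<close>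

definition T3_energy :: "nat \<Rightarrow> real" where
  "T3_energy n = 2 * sqrt (9 * (real n - 3) + 4 * (real n - 2) + 8 * sqrt (real n - 3))"

lemma ecc_energy_T3:
  assumes n: "n \<ge> 4"
  shows "ecc_energy (T3 n) = T3_energy n"
proof -
  interpret tree_graph "T3 n" using T3_tree[OF n] by (intro tree_graphI) (simp add: tree_on_def)
  have "double_star 1 2 {0} {3..<n}"
    using n unfolding double_star_def T3_arcs[OF n] by (auto simp: T3_def)
  from ecc_energy_double_star[OF this] show ?thesis using n by (simp add: T3_energy_def of_nat_diff)
qed

text \<open>For fixed \<open>a + b\<close> the formula increases with \<open>a * b\<close>, and
  \<open>(a - 1) * (b - 1) \<ge> 0\<close> bounds this product below by
  \<open>a + b - 1 = n - 3\<close>.\<close>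

lemma T3_energy_le_double_star:
  fixes a b :: nat
  assumes "a \<ge> 1" "b \<ge> 1" and n: "n = a + b + 2"
  shows "T3_energy n \<le> 2 * sqrt (9 * a * b + 4 * (real a + b) + 8 * sqrt (real a * b))"
proof -
  have "0 \<le> (real a - 1) * (real b - 1)" using assms by simp
  then have "real n - 3 \<le> real a * b" unfolding n by (simp add: algebra_simps)
  then show ?thesis unfolding T3_energy_def n
    by (intro mult_left_mono real_sqrt_le_mono add_mono) (auto simp: algebra_simps)
qed

lemma T3_energy_le_star:
  assumes n: "n \<ge> 5"
  shows "T3_energy n \<le> 2 * (real n - 2) + 2 * sqrt ((real n - 2)\<^sup>2 + (real n - 2) + 1)"
proof -
  define y where "y = sqrt (real n - 3)"
  have y2: "real n = y\<^sup>2 + 3" unfolding y_def using n by simp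
  \<comment> \<open>A rational bound just below sqrt 2, the least value of \<open>y\<close>. It is
    the larger zero of the quadratic that later absorbs the term \<open>8 * y\<close>.\<close>
  have "sqrt ((14/10)\<^sup>2) \<le> y" unfolding y_def using n by (intro real_sqrt_le_mono) (simp add: power2_eq_square)
  then have y: "y \<ge> 14/10" by simp
  define A where "A = real n - 2"
  have A: "A = y\<^sup>2 + 1" "A \<ge> 0" unfolding A_def y2 by auto
  have "A + 1/2 \<le> sqrt (A\<^sup>2 + A + 1)"
    by (rule real_le_rsqrt) (simp add: power2_eq_square algebra_simps)
  then have le: "2 * A + 1/2 \<le> A + sqrt (A\<^sup>2 + A + 1)" by simp
  have y22: "y\<^sup>2 \<ge> 2" using y2 n by simp
  have "0 \<le> (5 * y - 7) * (5 * y - 1)" using y by simp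
  then have "40 * y \<le> 25 * y\<^sup>2 + 7" by (simp add: power2_eq_square algebra_simps)
  moreover have "8 * y\<^sup>2 \<le> 4 * (y\<^sup>2 * y\<^sup>2)" using mult_right_mono[OF y22, of "y\<^sup>2"] by simp
  moreover have "(2 * A + 1/2)\<^sup>2 = 4 * (y\<^sup>2 * y\<^sup>2) + 10 * y\<^sup>2 + 25/4"
    unfolding A by (simp add: power2_eq_square algebra_simps)
  ultimately have "9 * y\<^sup>2 + 4 * (y\<^sup>2 + 1) + 8 * y \<le> (2 * A + 1/2)\<^sup>2" by simp
  then have "sqrt (9 * y\<^sup>2 + 4 * (y\<^sup>2 + 1) + 8 * y) \<le> 2 * A + 1/2"
    using A by (intro real_le_lsqrt) auto
  then have "2 * sqrt (9 * y\<^sup>2 + 4 * (y\<^sup>2 + 1) + 8 * y) \<le> 2 * A + 2 * sqrt (A\<^sup>2 + A + 1)"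
    using le by linarith
  moreover have "T3_energy n = 2 * sqrt (9 * y\<^sup>2 + 4 * (y\<^sup>2 + 1) + 8 * y)"
    unfolding T3_energy_def y_def[symmetric] using y2 by simp
  ultimately show ?thesis by (simp add: A_def)
qed

lemma T3_energy_le_long:
  assumes n: "n \<ge> 5" and E: "4 * (42 + 16 * (real n - 5)) \<le> E\<^sup>2" "0 \<le> E"
  shows "T3_energy n \<le> E"
proof -
  define y where "y = sqrt (real n - 3)"
  have y2: "real n = y\<^sup>2 + 3" unfolding y_def using n by simp
  \<comment> \<open>In terms of \<open>y\<close> the claim reads
    \<open>8 * y \<le> 3 * y\<^sup>2 + 6\<close>, and \<open>3 * y\<^sup>2 - 8 * y\<close> is least
    at \<open>y = 4/3\<close>.\<close>
  have "0 \<le> (3 * y - 4)\<^sup>2" by simp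
  then have "8 * y \<le> 3 * y\<^sup>2 + 6" by (simp add: power2_eq_square algebra_simps)
  then have "4 * (9 * (real n - 3) + 4 * (real n - 2) + 8 * y) \<le> E\<^sup>2" using E y2 by simp
  then have "sqrt (9 * (real n - 3) + 4 * (real n - 2) + 8 * y) \<le> E / 2"
    using E(2) by (intro real_le_lsqrt) (simp_all add: power_divide)
  then show ?thesis by (simp add: T3_energy_def y_def)
qed

lemma T3_energy_minimal:
  assumes n: "n \<ge> 5" and T: "tree_on n T"
  shows "T3_energy n \<le> ecc_energy T"
proof -
  interpret tree_graph T using T by (intro tree_graphI) (simp add: tree_on_def)
  have card: "card (pverts T) = n" using T by (simp add: tree_on_def)
  show ?thesis
  proof (cases rule: tree_shape_cases)
    case (star c)
    then show ?thesis using ecc_energy_star[OF star card] T3_energy_le_star[OF n] n by simp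
  next
    case (double x y A B)
    note c = double_star_card[OF double]
    show ?thesis
      using T3_energy_le_double_star[OF c(2,3), of n] c(1) card unfolding ecc_energy_double_star[OF double] by simp
  next
    case (long p d)
    interpret diametral_track T p d by (rule long(1))
    have "4 * (42 + 16 * (real n - 5)) \<le> (ecc_energy T)\<^sup>2"
      using sum_ecc_entry_square_ge[OF long(2)] ecc_energy_square_ge card by simp
    then show ?thesis using T3_energy_le_long[OF n] ecc_energy_nonneg by blast
  qed
qed

section \<open>Isomorphism with the star and the small cases\<close>

text \<open>Any bijection taking \<open>c\<close> to 0 works, because all arcs meet
  \<open>c\<close>: two other vertices are at distance 2 from each other.\<close>

lemma star_digraph_iso:
  assumes T: "tree_on n T" and c: "tree_graph.star_centre T c"
  shows "digraph_iso (with_proj T) (with_proj (star n))"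
proof -
  interpret tree_graph T using T by (intro tree_graphI) (simp add: tree_on_def)
  have cV: "c \<in> pverts T" and arcs: "\<And>u. u \<in> pverts T \<Longrightarrow> u \<noteq> c \<Longrightarrow> (c, u) \<in> parcs T"
    using c by (auto simp: star_centre_def)
  have card: "card (pverts T) = n" using T by (simp add: tree_on_def)
  then have "n \<ge> 1" using cV pair_finite_verts by (metis One_nat_def Suc_leI card_gt_0_iff empty_iff)
  have "card (pverts T - {c}) = card {1..<n}" using cV card pair_finite_verts by simp
  then obtain g0 where g0: "bij_betw g0 (pverts T - {c}) {1..<n}"
    using finite_same_card_bij[of "pverts T - {c}" "{1..<n}"] pair_finite_verts by auto
  define g where "g u = (if u = c then 0 else g0 u)" for u
  have "bij_betw g (pverts T - {c}) {1..<n}"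
    using g0 by (subst bij_betw_cong[of _ _ g0]) (auto simp: g_def)
  then have g': "inj_on g (pverts T - {c})" and gl: "g ` (pverts T - {c}) = {1..<n}"
    by (simp_all add: bij_betw_def)
  have ins: "pverts T = insert c (pverts T - {c})" using cV by auto
  have g: "inj_on g (pverts T)" "g ` pverts T = {..<n}"
  proof -
    have "g c \<notin> g ` (pverts T - {c})" unfolding gl by (simp add: g_def)
    then show "inj_on g (pverts T)" using g' by (subst ins) (simp only: inj_on_insert Diff_idemp simp_thms)
    have "g ` pverts T = insert (g c) {1..<n}" by (subst ins) (simp only: image_insert gl)
    then show "g ` pverts T = {..<n}" using \<open>n \<ge> 1\<close> by (auto simp: g_def)
  qed
  have gc: "g c = 0" by (simp add: g_def)
  have parcs: "parcs T = {c} \<times> (pverts T - {c}) \<union> (pverts T - {c}) \<times> {c}"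
  proof (intro equalityI subsetI)
    fix e assume e: "e \<in> parcs T"
    obtain u v where uv: "e = (u, v)" by (cases e)
    have V: "u \<in> pverts T" "v \<in> pverts T" "u \<noteq> v" using e uv wellformed' no_loops' by auto
    have "u = c \<or> v = c"
    proof (rule ccontr)
      assume "\<not> ?thesis"
      then have "hop u v = 2" using hop_2[of c u v] arcs V by auto
      then show False using hop_arc[of u v] e uv by simp
    qed
    then show "e \<in> {c} \<times> (pverts T - {c}) \<union> (pverts T - {c}) \<times> {c}" using uv V by auto
  qed (use arcs arcs_symmetric in auto)
  have img: "map_prod g g ` parcs T = {0} \<times> {1..<n} \<union> {1..<n} \<times> {0}"
  proof -
    have "map_prod g g ` (A \<times> B) = (g ` A) \<times> (g ` B)" for A B by force
    then show ?thesis unfolding parcs image_Un by (simp add: gc gl)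
  qed
  define f where "f = \<lparr>iso_verts = g, iso_arcs = map_prod g g, iso_head = snd, iso_tail = fst\<rparr>"
  have "inj_on (map_prod g g) (parcs T)"
    using g(1) wellformed' by (auto simp: inj_on_def)
  then have "digraph_isomorphism f"
    unfolding digraph_isomorphism_def f_def using g(1) wf_digraph_axioms by auto
  moreover have "with_proj (star n) = app_iso f (with_proj T)"
    by (simp add: app_iso_def f_def with_proj_def star_verts star_arcs g(2) img)
  ultimately show ?thesis unfolding digraph_iso_def by blast
qed

lemma digraph_iso_star_centre:
  assumes T: "tree_on n T" and n: "n \<ge> 2" and iso: "digraph_iso (with_proj T) (with_proj (star n))"
  shows "\<exists>c. tree_graph.star_centre T c"
proof -
  interpret tree_graph T using T by (intro tree_graphI) (simp add: tree_on_def)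
  obtain f where f: "digraph_isomorphism f" "with_proj (star n) = app_iso f (with_proj T)"
    using iso unfolding digraph_iso_def by blast
  have verts: "{..<n} = iso_verts f ` pverts T"
    using arg_cong[OF f(2), of verts] by (simp add: star_def)
  have arcs: "parcs (star n) = iso_arcs f ` parcs T" using arg_cong[OF f(2), of arcs] by simp
  \<comment> \<open>Equality of digraphs includes their tail and head functions, so those of
    \<open>f\<close> must be the projections.\<close>
  have th: "iso_tail f = fst" "iso_head f = snd"
    using arg_cong[OF f(2), of tail] arg_cong[OF f(2), of head] by simp_all
  have inj: "inj_on (iso_verts f) (pverts T)" using f(1) by (simp add: digraph_isomorphism_def)
  have "0 \<in> iso_verts f ` pverts T" using verts n by auto
  then obtain c where c: "c \<in> pverts T" "iso_verts f c = 0" by auto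
  have "(c, u) \<in> parcs T" if u: "u \<in> pverts T" "u \<noteq> c" for u
  proof -
    have "iso_verts f u \<noteq> 0" using inj_onD[OF inj, of u c] u c by auto
    moreover have "iso_verts f u < n" using verts u by auto
    ultimately have "(0, iso_verts f u) \<in> parcs (star n)" by (auto simp: star_def symcl_def)
    then obtain e where e: "e \<in> parcs T" "iso_arcs f e = (0, iso_verts f u)" using arcs by auto
    then have "iso_verts f (fst e) = iso_verts f c" "iso_verts f (snd e) = iso_verts f u"
      using f(1) th c unfolding digraph_isomorphism_def by auto
    then have "fst e = c" "snd e = u"
      using inj_onD[OF inj] e(1) c u arc_fst_in_verts arc_snd_in_verts by blast+
    then show ?thesis using e(1) by (metis prod.collapse)
  qed
  then show ?thesis using c by (auto simp: star_centre_def)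
qed

lemma ecc_energy_star_graph:
  assumes "n \<ge> 2"
  shows "ecc_energy (star n) = 2 * (real n - 2) + 2 * sqrt ((real n - 2)\<^sup>2 + (real n - 2) + 1)"
proof -
  have T: "tree_on n (star n)" using star_tree assms by simp
  interpret tree_graph "star n" using T by (intro tree_graphI) (simp add: tree_on_def)
  have "star_centre 0" using assms by (auto simp: star_centre_def star_verts star_arcs)
  then show ?thesis using ecc_energy_star T assms by (simp add: tree_on_def)
qed

text \<open>The only competitor of the star is the path on four vertices, a double star with one
  leaf at each centre. Its energy is 2 sqrt (9 + 8 + 8) = 10, above 4 + 2 sqrt 7 for the star
  because sqrt 7 < 3.\<close>

lemma small_tree_energy:
  assumes n: "n \<in> {2, 3, 4}" and T: "tree_on n T"
  shows "ecc_energy (star n) \<le> ecc_energy T \<and>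
    (ecc_energy T = ecc_energy (star n) \<longleftrightarrow> digraph_iso (with_proj T) (with_proj (star n)))"
proof -
  interpret tree_graph T using T by (intro tree_graphI) (simp add: tree_on_def)
  have card: "card (pverts T) = n" and n2: "n \<ge> 2" using T n by (auto simp: tree_on_def)
  show ?thesis
  proof (cases rule: tree_shape_cases)
    case (star c)
    then show ?thesis
      using ecc_energy_star[OF star card n2] ecc_energy_star_graph[OF n2] star_digraph_iso[OF T] by simp
  next
    case (double x y A B)
    have AB: "card A = 1" "card B = 1" "n = 4" using double_star_card[OF double] card n by auto
    have "sqrt (25::real) = 5" using real_sqrt_abs[of 5] by simp
    then have "ecc_energy T = 10" unfolding ecc_energy_double_star[OF double] AB by simp
    moreover have "ecc_energy (star n) < 10"
    proof -
      have "sqrt 7 < sqrt (3\<^sup>2)" by (subst real_sqrt_less_iff) simp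
      then show ?thesis using ecc_energy_star_graph[OF n2] unfolding AB by simp
    qed
    moreover have "\<not> digraph_iso (with_proj T) (with_proj (star n))"
      using digraph_iso_star_centre[OF T n2] double_star_not_star[OF double] by blast
    ultimately show ?thesis by simp
  next
    case (long p d)
    then show ?thesis using long_card[of p d] card n by auto
  qed
qed

theorem theorem4p8:
  shows "(\<forall>n\<in>{2, 3, 4}. tree_on n (star n) \<and>
            (\<forall>T :: 'a pair_pre_digraph. tree_on n T \<longrightarrow>
               ecc_energy (star n) \<le> ecc_energy T \<and>
               (ecc_energy T = ecc_energy (star n) \<longleftrightarrow>
                  digraph_iso (with_proj T) (with_proj (star n))))) \<and>
         (\<forall>n\<ge>5. tree_on n (T3 n) \<and>
            (\<forall>T :: 'a pair_pre_digraph. tree_on n T \<longrightarrow>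
               ecc_energy (T3 n) \<le> ecc_energy T))"
proof (intro conjI ballI allI impI)
  fix n :: nat assume n: "n \<in> {2, 3, 4}"
  then show "tree_on n (star n)" by (intro star_tree) auto
  fix T :: "'a pair_pre_digraph" assume "tree_on n T"
  from small_tree_energy[OF n this]
  show "ecc_energy (star n) \<le> ecc_energy T"
    "ecc_energy T = ecc_energy (star n) \<longleftrightarrow> digraph_iso (with_proj T) (with_proj (star n))" by auto
next
  fix n :: nat assume n: "n \<ge> 5"
  then show "tree_on n (T3 n)" by (intro T3_tree) simp
  fix T :: "'a pair_pre_digraph" assume "tree_on n T"
  then show "ecc_energy (T3 n) \<le> ecc_energy T"
    using T3_energy_minimal[OF n] ecc_energy_T3[of n] n by simp
qed

end
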